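(* Let $M_1,M_2\subset\mathbb{C}$ be compact and $d_1,d_2\ge 1$ integers. The Banach space $C(M_1\times M_2,\mathbb{C}^{d_1\times d_2})$ is canonically identified with the injective tensor product $C(M_1,\mathbb{C}^{d_1})\,\hat\otimes_\varepsilon\, C(M_2,\mathbb{C}^{d_2})$; that is, the linear map on the algebraic tensor product determined by sending $f\otimes g$ to the function $$(w_1,w_2)\mapsto \big(f_j(w_1)\,g_k(w_2)\big)_{1\le j\le d_1,\ 1\le k\le d_2}$$ extends to an isometric linear isomorphism $$C(M_1,\mathbb{C}^{d_1})\,\hat\otimes_\varepsilon\, C(M_2,\mathbb{C}^{d_2})\;\cong\; C(M_1\times M_2,\mathbb{C}^{d_1\times d_2}).$$
   Context: $C(M_i,\mathbb{C}^{d_i})$ is the space of continuous functions $M_i\to\mathbb{C}^{d_i}$ with norm $\|x\|=\max_{w\in M_i}\max_j|x_j(w)|$. $C(M_1\times M_2,\mathbb{C}^{d_1\times d_2})$ is the space of continuous functions with norm $|f|_\infty=\max_{j,k}\max_{(w_1,w_2)}|f_{j,k}(w_1,w_2)|$. For Banach spaces $X,Y$, the injective norm of $u=\sum_{i=1}^n x_i\otimes y_i$ in the algebraic tensor product of $X$ and $Y$ is $\|u\|_\varepsilon=\sup\{|\sum_{i=1}^n\varphi(x_i)\psi(y_i)|:\varphi\in X^*,\ \psi\in Y^*,\ \|\varphi\|\le1,\ \|\psi\|\le 1\}$, and $X\hat\otimes_\varepsilon Y$ is the completion of the algebraic tensor product in this norm. *)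

theory Defs
  imports
    "HOL-Analysis.Analysis"
    "HOL-Algebra.Module"
    "HOL-Algebra.AbelCoset"
    "HOL-Library.Poly_Mapping"
begin

text \<open>
  Complex vector spaces are the modules of HOL-Algebra over the field of complex numbers.
  The fields \<open>mult\<close> and \<open>one\<close>, which a module record inherits from rings, play no role and
  are left undefined, except in \<open>complex_field\<close>, which serves both as the scalar
  field and as the one-dimensional vector space over itself.
\<close>

definition complex_field :: "(complex, complex) module" where
  "complex_field =
     \<lparr>carrier = UNIV, mult = (*), one = 1, zero = 0, add = (+), smult = (*)\<rparr>"

record 'a normed_module = "(complex, 'a) module" +
  mnorm :: "'a \<Rightarrow> real"

definition with_norm :: "(complex, 'a) module \<Rightarrow> ('a \<Rightarrow> real) \<Rightarrow> 'a normed_module" where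
  "with_norm V N =
     \<lparr>carrier = carrier V, mult = mult V, one = one V, zero = zero V, add = add V,
      smult = smult V, mnorm = N\<rparr>"

definition lin_map ::
  "(complex, 'a, 'm) module_scheme \<Rightarrow> (complex, 'b, 'n) module_scheme \<Rightarrow> ('a \<Rightarrow> 'b) \<Rightarrow> bool" where
  "lin_map V W T \<longleftrightarrow>
     T \<in> carrier V \<rightarrow> carrier W \<and>
     (\<forall>x\<in>carrier V. \<forall>y\<in>carrier V. T (x \<oplus>\<^bsub>V\<^esub> y) = T x \<oplus>\<^bsub>W\<^esub> T y) \<and>
     (\<forall>c. \<forall>x\<in>carrier V. T (c \<odot>\<^bsub>V\<^esub> x) = c \<odot>\<^bsub>W\<^esub> T x)"

definition isometric_iso :: "'a normed_module \<Rightarrow> 'b normed_module \<Rightarrow> ('a \<Rightarrow> 'b) \<Rightarrow> bool" where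
  "isometric_iso V W T \<longleftrightarrow>
     lin_map V W T \<and> bij_betw T (carrier V) (carrier W) \<and>
     (\<forall>x\<in>carrier V. mnorm W (T x) = mnorm V x)"

text \<open>
  Scaling a coset takes representatives: for \<open>c = 0\<close> the set \<open>{c \<odot> x | x. x \<in> A}\<close>
  would not be a coset of \<open>N\<close>.
\<close>

definition quot_module :: "(complex, 'a, 'm) module_scheme \<Rightarrow> 'a set \<Rightarrow> (complex, 'a set) module" where
  "quot_module V N =
     \<lparr>carrier = a_rcosets\<^bsub>V\<^esub> N, mult = undefined, one = undefined, zero = N,
      add = (\<lambda>A B. A <+>\<^bsub>V\<^esub> B), smult = (\<lambda>c A. \<Union>x\<in>A. N +>\<^bsub>V\<^esub> (c \<odot>\<^bsub>V\<^esub> x))\<rparr>"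


subsection \<open>Algebraic tensor product\<close>

text \<open>
  The tensor product of \<open>X\<close> and \<open>Y\<close> is the free vector space on \<open>carrier X \<times> carrier Y\<close>
  modulo the subspace generated by the bilinearity relations.
\<close>

definition free_module :: "'a set \<Rightarrow> (complex, 'a \<Rightarrow>\<^sub>0 complex) module" where
  "free_module S =
     \<lparr>carrier = {r. Poly_Mapping.keys r \<subseteq> S}, mult = undefined, one = undefined, zero = 0,
      add = (+), smult = (\<lambda>c. Poly_Mapping.map ((*) c))\<rparr>"

definition bilinear_relations ::
  "(complex, 'a, 'm) module_scheme \<Rightarrow> (complex, 'b, 'n) module_scheme \<Rightarrow> ('a \<times> 'b \<Rightarrow>\<^sub>0 complex) set" where
  "bilinear_relations X Y =
     {Poly_Mapping.single (x \<oplus>\<^bsub>X\<^esub> x', y) 1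
        - Poly_Mapping.single (x, y) 1 - Poly_Mapping.single (x', y) 1 |
        x x' y. x \<in> carrier X \<and> x' \<in> carrier X \<and> y \<in> carrier Y} \<union>
     {Poly_Mapping.single (x, y \<oplus>\<^bsub>Y\<^esub> y') 1
        - Poly_Mapping.single (x, y) 1 - Poly_Mapping.single (x, y') 1 |
        x y y'. x \<in> carrier X \<and> y \<in> carrier Y \<and> y' \<in> carrier Y} \<union>
     {Poly_Mapping.single (c \<odot>\<^bsub>X\<^esub> x, y) 1 - Poly_Mapping.single (x, y) c |
        c x y. x \<in> carrier X \<and> y \<in> carrier Y} \<union>
     {Poly_Mapping.single (x, c \<odot>\<^bsub>Y\<^esub> y) 1 - Poly_Mapping.single (x, y) c |
        c x y. x \<in> carrier X \<and> y \<in> carrier Y}"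

definition tensor_null ::
  "(complex, 'a, 'm) module_scheme \<Rightarrow> (complex, 'b, 'n) module_scheme \<Rightarrow> ('a \<times> 'b \<Rightarrow>\<^sub>0 complex) set" where
  "tensor_null X Y =
     (\<lambda>N. submodule N complex_field (free_module (carrier X \<times> carrier Y)))
       hull bilinear_relations X Y"

definition alg_tensor ::
  "(complex, 'a, 'm) module_scheme \<Rightarrow> (complex, 'b, 'n) module_scheme \<Rightarrow>
     (complex, ('a \<times> 'b \<Rightarrow>\<^sub>0 complex) set) module" where
  "alg_tensor X Y = quot_module (free_module (carrier X \<times> carrier Y)) (tensor_null X Y)"

definition pure_tensor ::
  "(complex, 'a, 'm) module_scheme \<Rightarrow> (complex, 'b, 'n) module_scheme \<Rightarrow>
     'a \<Rightarrow> 'b \<Rightarrow> ('a \<times> 'b \<Rightarrow>\<^sub>0 complex) set" where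
  "pure_tensor X Y x y =
     tensor_null X Y +>\<^bsub>free_module (carrier X \<times> carrier Y)\<^esub> Poly_Mapping.single (x, y) 1"


subsection \<open>Injective norm\<close>

text \<open>
  A functional is only constrained on \<open>carrier X\<close>; its values elsewhere are irrelevant.
\<close>

definition dual :: "'a normed_module \<Rightarrow> ('a \<Rightarrow> complex) set" where
  "dual X = {\<phi>. lin_map X complex_field \<phi> \<and>
                (\<exists>K. \<forall>x\<in>carrier X. cmod (\<phi> x) \<le> K * mnorm X x)}"

definition dual_norm :: "'a normed_module \<Rightarrow> ('a \<Rightarrow> complex) \<Rightarrow> real" where
  "dual_norm X \<phi> = Sup {cmod (\<phi> x) | x. x \<in> carrier X \<and> mnorm X x \<le> 1}"

text \<open>
  The supremum also ranges over all representations of \<open>u\<close> as a sum of pure tensors.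
  This does not change it, since the inner sum does not depend on the representation.
\<close>

definition injective_norm ::
  "'a normed_module \<Rightarrow> 'b normed_module \<Rightarrow> ('a \<times> 'b \<Rightarrow>\<^sub>0 complex) set \<Rightarrow> real" where
  "injective_norm X Y u =
     Sup {cmod (\<Sum>i<n. \<phi> (x i) * \<psi> (y i)) | (n::nat) x y \<phi> \<psi>.
            x \<in> {..<n} \<rightarrow> carrier X \<and> y \<in> {..<n} \<rightarrow> carrier Y \<and>
            u = finsum (alg_tensor X Y) (\<lambda>i. pure_tensor X Y (x i) (y i)) {..<n} \<and>
            \<phi> \<in> dual X \<and> \<psi> \<in> dual Y \<and> dual_norm X \<phi> \<le> 1 \<and> dual_norm Y \<psi> \<le> 1}"


subsection \<open>Completion\<close>

definition cauchy_seqs :: "'a normed_module \<Rightarrow> (nat \<Rightarrow> 'a) set" where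
  "cauchy_seqs V =
     {s. (\<forall>n. s n \<in> carrier V) \<and>
         (\<forall>e>0. \<exists>N. \<forall>m\<ge>N. \<forall>n\<ge>N. mnorm V (s m \<ominus>\<^bsub>V\<^esub> s n) < e)}"

definition cauchy_module :: "'a normed_module \<Rightarrow> (complex, nat \<Rightarrow> 'a) module" where
  "cauchy_module V =
     \<lparr>carrier = cauchy_seqs V, mult = undefined, one = undefined, zero = (\<lambda>n. \<zero>\<^bsub>V\<^esub>),
      add = (\<lambda>s t n. s n \<oplus>\<^bsub>V\<^esub> t n), smult = (\<lambda>c s n. c \<odot>\<^bsub>V\<^esub> s n)\<rparr>"

definition null_seqs :: "'a normed_module \<Rightarrow> (nat \<Rightarrow> 'a) set" where
  "null_seqs V = {s \<in> cauchy_seqs V. (\<lambda>n. mnorm V (s n)) \<longlonglongrightarrow> 0}"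

definition completion :: "'a normed_module \<Rightarrow> (nat \<Rightarrow> 'a) set normed_module" where
  "completion V =
     with_norm (quot_module (cauchy_module V) (null_seqs V))
       (\<lambda>A. THE l. \<forall>s\<in>A. (\<lambda>n. mnorm V (s n)) \<longlonglongrightarrow> l)"

definition completion_embed :: "'a normed_module \<Rightarrow> 'a \<Rightarrow> (nat \<Rightarrow> 'a) set" where
  "completion_embed V x = null_seqs V +>\<^bsub>cauchy_module V\<^esub> (\<lambda>n. x)"

definition alg_tensor_injective ::
  "'a normed_module \<Rightarrow> 'b normed_module \<Rightarrow> ('a \<times> 'b \<Rightarrow>\<^sub>0 complex) set normed_module" where
  "alg_tensor_injective X Y = with_norm (alg_tensor X Y) (injective_norm X Y)"

definition injective_tensor ::
  "'a normed_module \<Rightarrow> 'b normed_module \<Rightarrow>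
     (nat \<Rightarrow> ('a \<times> 'b \<Rightarrow>\<^sub>0 complex) set) set normed_module" where
  "injective_tensor X Y = completion (alg_tensor_injective X Y)"


subsection \<open>Spaces of continuous functions\<close>

text \<open>
  Functions on a set \<open>S\<close> are represented by extensional functions, so that equality is equality
  on \<open>S\<close>. The parameter \<open>scl\<close> is the scalar multiplication of the codomain.
\<close>

definition cont_module ::
  "'a::topological_space set \<Rightarrow> (complex \<Rightarrow> 'v \<Rightarrow> 'v) \<Rightarrow> (complex, 'a \<Rightarrow> 'v::real_normed_vector) module" where
  "cont_module S scl =
     \<lparr>carrier = {f \<in> extensional S. continuous_on S f}, mult = undefined, one = undefined,
      zero = (\<lambda>w\<in>S. 0), add = (\<lambda>f g. \<lambda>w\<in>S. f w + g w), smult = (\<lambda>c f. \<lambda>w\<in>S. scl c (f w))\<rparr>"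

text \<open>
  The maxima over compact sets are written as suprema. The element 0 is inserted only so that
  the norm is 0 when the compact set is empty.
\<close>

definition cont_vec :: "complex set \<Rightarrow> (complex \<Rightarrow> complex ^ 'd::finite) normed_module" where
  "cont_vec M =
     with_norm (cont_module M (*s))
       (\<lambda>x. Sup (insert 0 ((\<lambda>w. MAX j\<in>UNIV. cmod (x w $ j)) ` M)))"

definition cont_mat ::
  "complex set \<Rightarrow> complex set \<Rightarrow>
     (complex \<times> complex \<Rightarrow> complex ^ 'd2::finite ^ 'd1::finite) normed_module" where
  "cont_mat M1 M2 =
     with_norm (cont_module (M1 \<times> M2) (\<lambda>c A. \<chi> j k. c * A $ j $ k))
       (\<lambda>f. MAX (j, k)\<in>UNIV. Sup (insert 0 ((\<lambda>w. cmod (f w $ j $ k)) ` (M1 \<times> M2))))"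

definition tensor_fun ::
  "complex set \<Rightarrow> complex set \<Rightarrow> (complex \<Rightarrow> complex ^ 'd1::finite) \<Rightarrow>
     (complex \<Rightarrow> complex ^ 'd2::finite) \<Rightarrow> complex \<times> complex \<Rightarrow> complex ^ 'd2 ^ 'd1" where
  "tensor_fun M1 M2 f g = (\<lambda>(w1, w2)\<in>M1 \<times> M2. \<chi> j k. f w1 $ j * g w2 $ k)"

end

theory Submission
  imports Defs
begin

text \<open>
  Let \<open>L\<close> be the linear map with \<open>L (f \<otimes> g) = (f\<^sub>j(w\<^sub>1) g\<^sub>k(w\<^sub>2))\<close>.
  It preserves norms. For \<open>u = \<Sum>\<^sub>i x\<^sub>i \<otimes> y\<^sub>i\<close> the evaluations
  \<open>x \<mapsto> x\<^sub>j(w\<^sub>1)\<close> and \<open>y \<mapsto> y\<^sub>k(w\<^sub>2)\<close> have norm at most 1, so the injective norm of \<open>u\<close> is at least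
  \<open>\<bar>L u\<bar>\<^sub>\<infinity>\<close>. Conversely, for functionals \<open>\<phi>\<close> and \<open>\<psi>\<close> in the dual unit balls,
  \<open>\<bar>\<Sum>\<^sub>i \<phi>(x\<^sub>i) \<psi>(y\<^sub>i)\<bar> = \<bar>\<phi>(\<Sum>\<^sub>i \<psi>(y\<^sub>i) x\<^sub>i)\<bar>\<close> is at most the maximum over \<open>w\<^sub>1\<close> and \<open>j\<close> of
  \<open>\<bar>\<Sum>\<^sub>i \<psi>(y\<^sub>i) x\<^sub>i(w\<^sub>1)\<^sub>j\<bar> = \<bar>\<psi>(\<Sum>\<^sub>i x\<^sub>i(w\<^sub>1)\<^sub>j y\<^sub>i)\<bar>\<close>, and the same step for \<open>\<psi>\<close> bounds this by \<open>\<bar>L u\<bar>\<^sub>\<infinity>\<close>;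
  the Hahn-Banach theorem is not involved. The range of \<open>L\<close> is dense by the Stone-Weierstrass theorem, because
  a real polynomial function on \<open>\<complex> \<times> \<complex>\<close> is a finite sum of products \<open>a(w\<^sub>1) b(w\<^sub>2)\<close>. A norm-preserving linear
  map with dense range into a Banach space extends to an isometric isomorphism from the completion.
\<close>

section \<open>Complex modules and their quotients\<close>

lemma complex_field_simps [simp]:
  "carrier complex_field = UNIV" "x \<otimes>\<^bsub>complex_field\<^esub> y = x * y" "\<one>\<^bsub>complex_field\<^esub> = 1"
  "\<zero>\<^bsub>complex_field\<^esub> = 0" "x \<oplus>\<^bsub>complex_field\<^esub> y = x + y" "x \<odot>\<^bsub>complex_field\<^esub> y = x * y"
  by (simp_all add: complex_field_def)

lemma cring_complex_field: "cring complex_field"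
proof (rule cringI)
  show "abelian_group complex_field"
    by (rule abelian_groupI) (simp_all add: algebra_simps exI[of _ "- x" for x])
  show "comm_monoid complex_field"
    by (rule comm_monoidI) (auto simp: algebra_simps)
qed (auto simp: algebra_simps)

lemma module_complexI:
  fixes V :: "(complex, 'a, 'm) module_scheme" (structure)
  assumes "\<And>x y. x \<in> carrier V \<Longrightarrow> y \<in> carrier V \<Longrightarrow> x \<oplus> y \<in> carrier V"
    and "\<zero> \<in> carrier V"
    and "\<And>x y z. x \<in> carrier V \<Longrightarrow> y \<in> carrier V \<Longrightarrow> z \<in> carrier V \<Longrightarrow> x \<oplus> y \<oplus> z = x \<oplus> (y \<oplus> z)"
    and "\<And>x y. x \<in> carrier V \<Longrightarrow> y \<in> carrier V \<Longrightarrow> x \<oplus> y = y \<oplus> x"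
    and "\<And>x. x \<in> carrier V \<Longrightarrow> \<zero> \<oplus> x = x"
    and "\<And>c x. x \<in> carrier V \<Longrightarrow> c \<odot> x \<in> carrier V"
    and "\<And>c d x. x \<in> carrier V \<Longrightarrow> (c + d) \<odot> x = c \<odot> x \<oplus> d \<odot> x"
    and "\<And>c x y. x \<in> carrier V \<Longrightarrow> y \<in> carrier V \<Longrightarrow> c \<odot> (x \<oplus> y) = c \<odot> x \<oplus> c \<odot> y"
    and "\<And>c d x. x \<in> carrier V \<Longrightarrow> (c * d) \<odot> x = c \<odot> (d \<odot> x)"
    and "\<And>x. x \<in> carrier V \<Longrightarrow> 1 \<odot> x = x"
    and "\<And>x. x \<in> carrier V \<Longrightarrow> 0 \<odot> x = \<zero>"
  shows "module complex_field V"
proof (rule moduleI)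
  have "(-1) \<odot> x \<oplus> x = \<zero>" if "x \<in> carrier V" for x
    using assms(7)[OF that, of "-1" 1] assms(10,11)[OF that] by simp
  then have "\<exists>y\<in>carrier V. y \<oplus> x = \<zero>" if "x \<in> carrier V" for x
    using that assms(6) by blast
  then show "abelian_group V"
    by (intro abelian_groupI assms)
qed (simp_all add: assms cring_complex_field)

lemma with_norm_simps [simp]:
  "carrier (with_norm V N) = carrier V" "\<zero>\<^bsub>with_norm V N\<^esub> = \<zero>\<^bsub>V\<^esub>"
  "x \<oplus>\<^bsub>with_norm V N\<^esub> y = x \<oplus>\<^bsub>V\<^esub> y" "c \<odot>\<^bsub>with_norm V N\<^esub> x = c \<odot>\<^bsub>V\<^esub> x"
  "mnorm (with_norm V N) = N"
  by (simp_all add: with_norm_def)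

lemma module_with_norm:
  assumes "module complex_field V"
  shows "module complex_field (with_norm V N)"
proof -
  interpret module complex_field V by fact
  show ?thesis
    by (rule module_complexI)
      (simp_all add: smult_l_distr[simplified] smult_r_distr[simplified] smult_assoc1[simplified]
        smult_one[simplified] smult_l_null[simplified] smult_closed[simplified] M.a_assoc M.a_comm M.a_lcomm)
qed

lemma lin_map_with_norm [simp]: "lin_map (with_norm V N) W T \<longleftrightarrow> lin_map V W T"
  by (simp add: lin_map_def)

section \<open>Linear maps, differences and kernels\<close>

lemma lin_mapD:
  assumes "lin_map V W T" and "x \<in> carrier V"
  shows "T x \<in> carrier W" and "y \<in> carrier V \<Longrightarrow> T (x \<oplus>\<^bsub>V\<^esub> y) = T x \<oplus>\<^bsub>W\<^esub> T y"
    and "T (c \<odot>\<^bsub>V\<^esub> x) = c \<odot>\<^bsub>W\<^esub> T x"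
  using assms by (auto simp: lin_map_def)

text \<open>Differences are defined through negation. As a scalar multiple, negation is covered by
  what is known of addition and scaling, in particular for linear maps.\<close>

lemma module_uminus:
  assumes "module complex_field V" and "x \<in> carrier V"
  shows "\<ominus>\<^bsub>V\<^esub> x = (-1) \<odot>\<^bsub>V\<^esub> x"
proof -
  interpret module complex_field V by fact
  have "(-1) \<odot>\<^bsub>V\<^esub> x \<oplus>\<^bsub>V\<^esub> x = \<zero>\<^bsub>V\<^esub>"
    using smult_l_distr[of "-1" 1 x] smult_one[of x] smult_l_null[of x] assms(2) by simp
  then show ?thesis
    using assms(2) by (intro M.minus_equality) auto
qed

lemma (in abelian_group) minus_eq_zeroD:
  assumes "x \<in> carrier G" "y \<in> carrier G" "x \<ominus> y = \<zero>"
  shows "x = y"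
  using assms minus_equality[of x "\<ominus> y"] by (simp add: a_minus_def)

lemma lin_map_zero:
  assumes "module complex_field V" "module complex_field W" "lin_map V W T"
  shows "T \<zero>\<^bsub>V\<^esub> = \<zero>\<^bsub>W\<^esub>"
proof -
  interpret V: module complex_field V by fact
  interpret W: module complex_field W by fact
  have "T (0 \<odot>\<^bsub>V\<^esub> \<zero>\<^bsub>V\<^esub>) = 0 \<odot>\<^bsub>W\<^esub> T \<zero>\<^bsub>V\<^esub>"
    using lin_mapD(3)[OF assms(3) V.M.zero_closed] .
  then show ?thesis
    using V.smult_l_null[of "\<zero>\<^bsub>V\<^esub>"] W.smult_l_null[of "T \<zero>\<^bsub>V\<^esub>"] lin_mapD(1)[OF assms(3)] by simp
qed

lemma lin_map_minus:
  assumes V: "module complex_field V" and W: "module complex_field W" and T: "lin_map V W T"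
    and x: "x \<in> carrier V" and y: "y \<in> carrier V"
  shows "T (x \<ominus>\<^bsub>V\<^esub> y) = T x \<ominus>\<^bsub>W\<^esub> T y"
proof -
  interpret V: module complex_field V by fact
  show ?thesis
    using lin_mapD[OF T] x y module_uminus[OF V] module_uminus[OF W] V.smult_closed
    by (simp add: a_minus_def)
qed

lemma submodule_kernel:
  assumes V: "module complex_field V" and W: "module complex_field W" and T: "lin_map V W T"
  shows "submodule {x \<in> carrier V. T x = \<zero>\<^bsub>W\<^esub>} complex_field V"
proof -
  interpret V: module complex_field V by fact
  interpret W: module complex_field W by fact
  show ?thesis
    by (rule V.submoduleI)
      (auto simp: lin_mapD[OF T] lin_map_zero[OF assms] module_uminus[OF V] V.smult_closed[simplified]
        W.smult_r_null[simplified])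
qed

text \<open>Instantiated twice: for the free module modulo the bilinearity relations, and for the
  Cauchy sequences modulo the null sequences.\<close>

locale quotient_module =
  module complex_field V + submodule N complex_field V
  for V :: "(complex, 'a, 'm) module_scheme" (structure) and N
begin

sublocale abelian_subgroup N V
  by (rule abelian_subgroupI3) (simp_all add: additive_subgroup_def subgroup_axioms M.abelian_group_axioms)

lemma carrier_quot: "carrier (quot_module V N) = {N +> x |x. x \<in> carrier V}"
  by (auto simp: quot_module_def A_RCOSETS_def' a_r_coset_def)

lemma zero_quot: "\<zero>\<^bsub>quot_module V N\<^esub> = N +> \<zero>"
  by (simp add: quot_module_def a_subset)

lemma coset_eq_iff:
  assumes "x \<in> carrier V" "y \<in> carrier V"
  shows "N +> x = N +> y \<longleftrightarrow> x \<ominus> y \<in> N"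
  using a_rcos_module[of y x] a_repr_independence'[of x y] a_rcos_self[of x] assms
  by (auto simp: a_minus_def)

lemma add_quot:
  assumes "x \<in> carrier V" "y \<in> carrier V"
  shows "(N +> x) \<oplus>\<^bsub>quot_module V N\<^esub> (N +> y) = N +> (x \<oplus> y)"
  using a_rcos_sum[OF assms] by (simp add: quot_module_def)

lemma smult_quot:
  assumes "x \<in> carrier V"
  shows "c \<odot>\<^bsub>quot_module V N\<^esub> (N +> x) = N +> (c \<odot> x)"
proof -
  \<comment> \<open>The coset of \<open>c \<odot> y\<close> is the same for all representatives
    \<open>y\<close>, because \<open>c \<odot> (y \<ominus> x)\<close> stays in \<open>N\<close>.
    The union in the definition of the scalar multiplication is therefore a union of equal sets over
    a nonempty index set.\<close>
  have eq: "N +> (c \<odot> y) = N +> (c \<odot> x)" if y: "y \<in> N +> x" for y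
  proof -
    have yV: "y \<in> carrier V"
      using y assms a_elemrcos_carrier by blast
    have "N +> y = N +> x"
      using a_repr_independence'[OF y assms] by simp
    then have "c \<odot> (y \<ominus> x) \<in> N"
      using coset_eq_iff[OF yV assms] by simp
    moreover have "c \<odot> (y \<ominus> x) = c \<odot> y \<ominus> c \<odot> x"
      using yV assms smult_r_distr smult_r_minus by (simp add: a_minus_def)
    ultimately show ?thesis
      using coset_eq_iff yV assms by simp
  qed
  have "N +> x \<noteq> {}"
    using a_rcos_self[OF assms] by blast
  then have "(\<Union>y\<in>N +> x. N +> (c \<odot> y)) = N +> (c \<odot> x)"
    by (rule SUP_eq_const) (rule eq)
  then show ?thesis
    by (simp add: quot_module_def)
qed

lemma module_quot: "module complex_field (quot_module V N)"
proof (rule module_complexI)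
  fix A assume "A \<in> carrier (quot_module V N)"
  then obtain x where x: "x \<in> carrier V" and A: "A = N +> x"
    by (auto simp: carrier_quot)
  show "0 \<odot>\<^bsub>quot_module V N\<^esub> A = \<zero>\<^bsub>quot_module V N\<^esub>"
    using x smult_l_null[OF x] unfolding A smult_quot[OF x] zero_quot by simp
  show "1 \<odot>\<^bsub>quot_module V N\<^esub> A = A"
    using x smult_one[OF x] unfolding A smult_quot[OF x] by simp
  show "\<zero>\<^bsub>quot_module V N\<^esub> \<oplus>\<^bsub>quot_module V N\<^esub> A = A"
    unfolding A zero_quot using x add_quot[OF M.zero_closed x] by simp
  fix c d
  show "c \<odot>\<^bsub>quot_module V N\<^esub> A \<in> carrier (quot_module V N)"
    unfolding A smult_quot[OF x] carrier_quot using x by auto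
  show "(c * d) \<odot>\<^bsub>quot_module V N\<^esub> A = c \<odot>\<^bsub>quot_module V N\<^esub> (d \<odot>\<^bsub>quot_module V N\<^esub> A)"
    unfolding A using x smult_assoc1[of c d x] by (simp add: smult_quot)
  show "(c + d) \<odot>\<^bsub>quot_module V N\<^esub> A = c \<odot>\<^bsub>quot_module V N\<^esub> A \<oplus>\<^bsub>quot_module V N\<^esub> d \<odot>\<^bsub>quot_module V N\<^esub> A"
    unfolding A using x smult_l_distr[of c d x] by (simp add: smult_quot add_quot)
next
  fix A B assume "A \<in> carrier (quot_module V N)" "B \<in> carrier (quot_module V N)"
  then obtain x y where xy: "x \<in> carrier V" "y \<in> carrier V" and AB: "A = N +> x" "B = N +> y"
    by (auto simp: carrier_quot)
  show "A \<oplus>\<^bsub>quot_module V N\<^esub> B \<in> carrier (quot_module V N)"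
    unfolding AB add_quot[OF xy] carrier_quot using xy by auto
  show "A \<oplus>\<^bsub>quot_module V N\<^esub> B = B \<oplus>\<^bsub>quot_module V N\<^esub> A"
    unfolding AB using xy by (simp add: add_quot M.a_comm)
  fix c
  show "c \<odot>\<^bsub>quot_module V N\<^esub> (A \<oplus>\<^bsub>quot_module V N\<^esub> B) =
    c \<odot>\<^bsub>quot_module V N\<^esub> A \<oplus>\<^bsub>quot_module V N\<^esub> c \<odot>\<^bsub>quot_module V N\<^esub> B"
    unfolding AB using xy smult_r_distr[of c x y] by (simp add: add_quot smult_quot)
next
  fix A B C assume "A \<in> carrier (quot_module V N)" "B \<in> carrier (quot_module V N)" "C \<in> carrier (quot_module V N)"
  then obtain x y z where "x \<in> carrier V" "y \<in> carrier V" "z \<in> carrier V"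
    and "A = N +> x" "B = N +> y" "C = N +> z"
    by (auto simp: carrier_quot)
  then show "A \<oplus>\<^bsub>quot_module V N\<^esub> B \<oplus>\<^bsub>quot_module V N\<^esub> C = A \<oplus>\<^bsub>quot_module V N\<^esub> (B \<oplus>\<^bsub>quot_module V N\<^esub> C)"
    by (simp add: add_quot M.a_assoc)
next
  show "\<zero>\<^bsub>quot_module V N\<^esub> \<in> carrier (quot_module V N)"
    unfolding carrier_quot zero_quot by blast
qed

text \<open>Universal property of the quotient: two representatives of a coset differ by an element
  of \<open>N\<close>, which \<open>T\<close> sends to zero, so \<open>T\<close> is constant on each
  coset.\<close>

lemma quotient_lift:
  assumes W: "module complex_field W" and T: "lin_map V W T" and 0: "\<And>x. x \<in> N \<Longrightarrow> T x = \<zero>\<^bsub>W\<^esub>"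
  obtains T' where "lin_map (quot_module V N) W T'" "\<And>x. x \<in> carrier V \<Longrightarrow> T' (N +> x) = T x"
proof -
  interpret W: module complex_field W by fact
  have eq: "T y = T x" if x: "x \<in> carrier V" and y: "y \<in> N +> x" for x y
  proof -
    have yV: "y \<in> carrier V"
      using y x a_elemrcos_carrier by blast
    have "N +> y = N +> x"
      using a_repr_independence'[OF y x] by simp
    then have "T (y \<ominus> x) = \<zero>\<^bsub>W\<^esub>"
      using coset_eq_iff[OF yV x] 0 by simp
    then show ?thesis
      using lin_map_minus[OF module_axioms W T yV x] lin_mapD(1)[OF T] x yV
        W.M.minus_eq_zeroD[of "T y" "T x"] by simp
  qed
  \<comment> \<open>The image of a coset under \<open>T\<close> is a singleton, and
    \<open>the_elem\<close> extracts its element.\<close>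
  define T' where "T' A = the_elem (T ` A)" for A
  have T': "T' (N +> x) = T x" if x: "x \<in> carrier V" for x
  proof -
    have "T ` (N +> x) = (\<lambda>_. T x) ` (N +> x)"
      by (rule image_cong[OF refl eq[OF x]])
    also have "\<dots> = {T x}"
      by (rule image_constant[OF a_rcos_self[OF x]])
    finally have "T ` (N +> x) = {T x}" .
    then show ?thesis
      by (simp add: T'_def)
  qed
  have "lin_map (quot_module V N) W T'"
    unfolding lin_map_def using lin_mapD[OF T]
    by (auto simp: carrier_quot T' add_quot smult_quot)
  then show thesis
    using T' that by blast
qed

end

section \<open>Completions\<close>

text \<open>The space is a carrier set inside a type and has its own operations, so the type classes
  of normed spaces do not apply to it. Limits are likewise expressed through \<open>mnorm\<close>,
  by \<open>tends\<close>.\<close>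

locale complex_banach = module complex_field Z
  for Z :: "'b normed_module" (structure) +
  assumes norm_eq_zeroD: "x \<in> carrier Z \<Longrightarrow> mnorm Z x = 0 \<Longrightarrow> x = \<zero>"
    and norm_triangle: "x \<in> carrier Z \<Longrightarrow> y \<in> carrier Z \<Longrightarrow> mnorm Z (x \<oplus> y) \<le> mnorm Z x + mnorm Z y"
    and norm_smult: "x \<in> carrier Z \<Longrightarrow> mnorm Z (c \<odot> x) = cmod c * mnorm Z x"
    and complete: "(\<And>n. s n \<in> carrier Z) \<Longrightarrow> (\<And>e. e > 0 \<Longrightarrow> \<exists>N. \<forall>m\<ge>N. \<forall>n\<ge>N. mnorm Z (s m \<ominus> s n) < e)
      \<Longrightarrow> \<exists>z\<in>carrier Z. (\<lambda>n. mnorm Z (s n \<ominus> z)) \<longlonglongrightarrow> 0"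
begin

definition tends :: "(nat \<Rightarrow> 'b) \<Rightarrow> 'b \<Rightarrow> bool" where
  "tends s z \<longleftrightarrow> z \<in> carrier Z \<and> (\<lambda>n. mnorm Z (s n \<ominus> z)) \<longlonglongrightarrow> 0"

lemmas uminus_eq = module_uminus[OF module_axioms]
lemmas smult_facts = smult_closed[simplified] smult_l_distr[simplified] smult_r_distr[simplified]
  smult_assoc1[simplified] smult_one[simplified] smult_l_null[simplified] smult_r_null[simplified]

lemma norm_zero: "mnorm Z \<zero> = 0"
  using norm_smult[of \<zero> 0] smult_facts by simp

lemma diff_zero: "x \<in> carrier Z \<Longrightarrow> x \<ominus> \<zero> = x"
  using smult_facts by (simp add: a_minus_def uminus_eq)

lemma norm_minus: "x \<in> carrier Z \<Longrightarrow> mnorm Z (\<ominus> x) = mnorm Z x"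
  using norm_smult[of x "-1"] by (simp add: uminus_eq)

text \<open>The triangle inequality for \<open>x\<close> and \<open>\<ominus> x\<close> gives
  \<open>0 \<le> 2 * mnorm Z x\<close>.\<close>

lemma norm_nonneg: "x \<in> carrier Z \<Longrightarrow> 0 \<le> mnorm Z x"
  using norm_triangle[of x "\<ominus> x"] by (simp add: norm_minus M.r_neg norm_zero)

lemma dist_commute:
  assumes "x \<in> carrier Z" "y \<in> carrier Z"
  shows "mnorm Z (x \<ominus> y) = mnorm Z (y \<ominus> x)"
proof -
  have "\<ominus> (x \<ominus> y) = y \<ominus> x"
    using assms by (simp add: a_minus_def M.minus_add M.a_comm)
  then show ?thesis
    using norm_minus[of "x \<ominus> y"] assms by simp
qed

lemma dist_triangle:
  assumes "x \<in> carrier Z" "y \<in> carrier Z" "z \<in> carrier Z"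
  shows "mnorm Z (x \<ominus> z) \<le> mnorm Z (x \<ominus> y) + mnorm Z (y \<ominus> z)"
proof -
  have "(x \<ominus> y) \<oplus> (y \<ominus> z) = x \<ominus> z"
    using assms by (simp add: a_minus_def M.a_assoc M.r_neg1 M.l_neg M.r_neg2)
  then show ?thesis
    using norm_triangle[of "x \<ominus> y" "y \<ominus> z"] assms by simp
qed

lemma norm_diff:
  assumes "x \<in> carrier Z" "y \<in> carrier Z"
  shows "\<bar>mnorm Z x - mnorm Z y\<bar> \<le> mnorm Z (x \<ominus> y)"
  using dist_triangle[OF assms M.zero_closed] dist_triangle[OF assms(2,1) M.zero_closed]
    dist_commute[OF assms] assms
  by (simp add: diff_zero)

lemma tends_unique:
  assumes "\<And>n. s n \<in> carrier Z" and z: "tends s z" "tends s z'"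
  shows "z = z'"
proof (rule M.minus_eq_zeroD)
  have zc: "z \<in> carrier Z" "z' \<in> carrier Z"
    using z by (auto simp: tends_def)
  have "(\<lambda>n. mnorm Z (s n \<ominus> z) + mnorm Z (s n \<ominus> z')) \<longlonglongrightarrow> 0 + 0"
    using z by (intro tendsto_add) (auto simp: tends_def)
  moreover have "mnorm Z (z \<ominus> z') \<le> mnorm Z (s n \<ominus> z) + mnorm Z (s n \<ominus> z')" for n
    using dist_triangle[of z "s n" z'] dist_commute[of z "s n"] assms(1) zc by simp
  ultimately have "mnorm Z (z \<ominus> z') \<le> 0"
    using LIMSEQ_le_const by fastforce
  then show "z \<ominus> z' = \<zero>"
    using norm_eq_zeroD[of "z \<ominus> z'"] norm_nonneg[of "z \<ominus> z'"] zc by simp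
qed (use z in \<open>auto simp: tends_def\<close>)

lemma tends_add:
  assumes c: "\<And>n. s n \<in> carrier Z" "\<And>n. t n \<in> carrier Z" and z: "tends s y" "tends t z"
  shows "tends (\<lambda>n. s n \<oplus> t n) (y \<oplus> z)"
proof -
  have yz: "y \<in> carrier Z" "z \<in> carrier Z"
    using z by (auto simp: tends_def)
  have eq: "s n \<oplus> t n \<ominus> (y \<oplus> z) = (s n \<ominus> y) \<oplus> (t n \<ominus> z)" for n
    using c[of n] yz by (simp add: a_minus_def M.minus_add M.a_assoc M.a_lcomm M.a_comm)
  have "(\<lambda>n. mnorm Z (s n \<oplus> t n \<ominus> (y \<oplus> z))) \<longlonglongrightarrow> 0"
  proof (rule tendsto_sandwich[OF _ _ tendsto_const])
    show "(\<lambda>n. mnorm Z (s n \<ominus> y) + mnorm Z (t n \<ominus> z)) \<longlonglongrightarrow> 0"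
      using z by (intro tendsto_add_zero) (auto simp: tends_def)
  qed (use c yz in \<open>auto simp: eq intro!: always_eventually norm_nonneg norm_triangle\<close>)
  then show ?thesis
    using yz by (simp add: tends_def)
qed

lemma tends_smult:
  assumes c: "\<And>n. s n \<in> carrier Z" and z: "tends s z"
  shows "tends (\<lambda>n. c \<odot> s n) (c \<odot> z)"
proof -
  have zc: "z \<in> carrier Z"
    using z by (auto simp: tends_def)
  have eq: "c \<odot> s n \<ominus> c \<odot> z = c \<odot> (s n \<ominus> z)" for n
    using c[of n] zc smult_r_minus[of c z] smult_facts by (simp add: a_minus_def)
  have "(\<lambda>n. cmod c * mnorm Z (s n \<ominus> z)) \<longlonglongrightarrow> cmod c * 0"
    using z by (intro tendsto_mult_left) (auto simp: tends_def)
  then show ?thesis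
    using c zc smult_facts by (simp add: tends_def eq norm_smult)
qed

lemma tends_const: "z \<in> carrier Z \<Longrightarrow> tends (\<lambda>n. z) z"
  by (simp add: tends_def a_minus_def M.r_neg norm_zero)

lemma tends_norm:
  assumes c: "\<And>n. s n \<in> carrier Z" and z: "tends s z"
  shows "(\<lambda>n. mnorm Z (s n)) \<longlonglongrightarrow> mnorm Z z"
proof (rule LIM_zero_cancel, rule tendsto_rabs_zero_cancel)
  have zc: "z \<in> carrier Z"
    using z by (auto simp: tends_def)
  show "(\<lambda>n. \<bar>mnorm Z (s n) - mnorm Z z\<bar>) \<longlonglongrightarrow> 0"
    by (rule tendsto_sandwich[OF _ _ tendsto_const])
      (use z norm_diff[OF c zc] in \<open>auto simp: tends_def\<close>)
qed

lemma tends_zero_iff: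
  assumes c: "\<And>n. s n \<in> carrier Z"
  shows "tends s \<zero> \<longleftrightarrow> (\<lambda>n. mnorm Z (s n)) \<longlonglongrightarrow> 0"
  using c by (simp add: tends_def diff_zero)

text \<open>Lets the Cauchy sequences of a space mapped isometrically into \<open>Z\<close> be
  treated as the sequences whose images have a limit, so that every closure property becomes a limit
  law.\<close>

lemma cauchy_iff_tends:
  assumes c: "\<And>n. s n \<in> carrier Z"
  shows "(\<forall>e>0. \<exists>N. \<forall>m\<ge>N. \<forall>n\<ge>N. mnorm Z (s m \<ominus> s n) < e) \<longleftrightarrow> (\<exists>z. tends s z)"
proof
  assume "\<forall>e>0. \<exists>N. \<forall>m\<ge>N. \<forall>n\<ge>N. mnorm Z (s m \<ominus> s n) < e"
  then show "\<exists>z. tends s z"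
    using complete[of s] c by (auto simp: tends_def)
next
  assume "\<exists>z. tends s z"
  then obtain z where z: "z \<in> carrier Z" "(\<lambda>n. mnorm Z (s n \<ominus> z)) \<longlonglongrightarrow> 0"
    by (auto simp: tends_def)
  show "\<forall>e>0. \<exists>N. \<forall>m\<ge>N. \<forall>n\<ge>N. mnorm Z (s m \<ominus> s n) < e"
  proof (intro allI impI)
    fix e :: real assume "e > 0"
    then have "\<forall>\<^sub>F n in sequentially. mnorm Z (s n \<ominus> z) < e / 2"
      using z(2) by (intro order_tendstoD) auto
    then obtain N where N: "\<And>n. n \<ge> N \<Longrightarrow> mnorm Z (s n \<ominus> z) < e / 2"
      by (auto simp: eventually_sequentially)
    have "mnorm Z (s m \<ominus> s n) < e" if "m \<ge> N" "n \<ge> N" for m n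
      using dist_triangle[OF c[of m] z(1) c[of n]] dist_commute[OF c[of n] z(1)] N[of m] N[of n] that
      by simp
    then show "\<exists>N. \<forall>m\<ge>N. \<forall>n\<ge>N. mnorm Z (s m \<ominus> s n) < e"
      by blast
  qed
qed

end

text \<open>Send a Cauchy sequence \<open>s\<close> to the limit of \<open>L (s n)\<close>. Because
  \<open>L\<close> preserves norms, this linear map has exactly the null sequences as its kernel, so
  it descends to an injective map on the completion. Density of the range of \<open>L\<close> makes
  it surjective, and continuity of the norm makes it isometric. All norm facts about
  \<open>V\<close> are read off in \<open>Z\<close> through \<open>L\<close>.\<close>

lemma completion_isometric_iso:
  fixes V :: "'a normed_module" and Z :: "'b normed_module"
  assumes V: "module complex_field V" and Z: "complex_banach Z" and L: "lin_map V Z L"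
    and iso: "\<And>v. v \<in> carrier V \<Longrightarrow> mnorm Z (L v) = mnorm V v"
    and dense: "\<And>z e. z \<in> carrier Z \<Longrightarrow> e > 0 \<Longrightarrow> \<exists>v\<in>carrier V. mnorm Z (L v \<ominus>\<^bsub>Z\<^esub> z) < e"
  obtains T where "isometric_iso (completion V) Z T"
    and "\<And>v. v \<in> carrier V \<Longrightarrow> T (completion_embed V v) = L v"
proof -
  interpret V: module complex_field V by fact
  interpret Z: complex_banach Z by fact
  note LD = lin_mapD[OF L]
  note Zmod = Z.module_axioms
  note Vf = V.smult_closed[simplified] V.smult_l_distr[simplified] V.smult_r_distr[simplified]
    V.smult_assoc1[simplified] V.smult_one[simplified] V.smult_l_null[simplified]
  let ?C = "cauchy_module V"
  \<comment> \<open>\<open>L\<close> preserves the norms of differences, so \<open>s\<close> is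
    Cauchy in \<open>V\<close> iff its image is Cauchy in \<open>Z\<close>, which by completeness
    means convergent.\<close>
  have cauchy: "s \<in> carrier ?C \<longleftrightarrow> (\<forall>n. s n \<in> carrier V) \<and> (\<exists>z. Z.tends (\<lambda>n. L (s n)) z)" for s
  proof (cases "\<forall>n. s n \<in> carrier V")
    case True
    then have "mnorm V (s m \<ominus>\<^bsub>V\<^esub> s n) = mnorm Z (L (s m) \<ominus>\<^bsub>Z\<^esub> L (s n))" for m n
      using iso[of "s m \<ominus>\<^bsub>V\<^esub> s n"] lin_map_minus[OF V Zmod L] by simp
    then show ?thesis
      using True Z.cauchy_iff_tends[of "\<lambda>n. L (s n)"] LD(1)
      by (simp add: cauchy_module_def cauchy_seqs_def)
  qed (auto simp: cauchy_module_def cauchy_seqs_def)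
  have C_simps: "\<zero>\<^bsub>?C\<^esub> = (\<lambda>n. \<zero>\<^bsub>V\<^esub>)" "s \<oplus>\<^bsub>?C\<^esub> t = (\<lambda>n. s n \<oplus>\<^bsub>V\<^esub> t n)" "c \<odot>\<^bsub>?C\<^esub> s = (\<lambda>n. c \<odot>\<^bsub>V\<^esub> s n)"
    for s t c
    by (simp_all add: cauchy_module_def)
  have const: "(\<lambda>n. v) \<in> carrier ?C" "Z.tends (\<lambda>n. L v) (L v)" if "v \<in> carrier V" for v
    using that Z.tends_const[of "L v"] LD(1) cauchy by auto
  have add: "Z.tends (\<lambda>n. L (s n \<oplus>\<^bsub>V\<^esub> t n)) (y \<oplus>\<^bsub>Z\<^esub> z)"
    if "\<forall>n. s n \<in> carrier V" "\<forall>n. t n \<in> carrier V" "Z.tends (\<lambda>n. L (s n)) y" "Z.tends (\<lambda>n. L (t n)) z" for s t y z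
    using that Z.tends_add[of "\<lambda>n. L (s n)" "\<lambda>n. L (t n)"] LD by simp
  have smult: "Z.tends (\<lambda>n. L (c \<odot>\<^bsub>V\<^esub> s n)) (c \<odot>\<^bsub>Z\<^esub> z)"
    if "\<forall>n. s n \<in> carrier V" "Z.tends (\<lambda>n. L (s n)) z" for s c z
    using that Z.tends_smult[of "\<lambda>n. L (s n)"] LD by simp
  have C: "module complex_field ?C"
  proof (rule module_complexI)
    fix s t assume st: "s \<in> carrier ?C" "t \<in> carrier ?C"
    show "s \<oplus>\<^bsub>?C\<^esub> t \<in> carrier ?C"
      using st add[of s t] unfolding cauchy C_simps by blast
    show "s \<oplus>\<^bsub>?C\<^esub> t = t \<oplus>\<^bsub>?C\<^esub> s"
      using st unfolding cauchy C_simps by (auto simp: V.M.a_comm)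
  qed (use smult const(1) in \<open>auto simp: cauchy C_simps Vf V.M.a_assoc\<close>)
  interpret C: module complex_field ?C by fact
  \<comment> \<open>Limits in \<open>Z\<close> are unique, which makes this description well-defined
    on Cauchy sequences.\<close>
  define \<Lambda> where "\<Lambda> s = (THE z. Z.tends (\<lambda>n. L (s n)) z)" for s
  have \<Lambda>I: "\<Lambda> s = z" if "\<forall>n. s n \<in> carrier V" "Z.tends (\<lambda>n. L (s n)) z" for s z
    unfolding \<Lambda>_def using that LD(1) by (intro the_equality Z.tends_unique[of "\<lambda>n. L (s n)"]) auto
  have \<Lambda>: "Z.tends (\<lambda>n. L (s n)) (\<Lambda> s)" if "s \<in> carrier ?C" for s
    using that \<Lambda>I unfolding cauchy by blast
  have \<Lambda>_closed: "\<Lambda> s \<in> carrier Z" if "s \<in> carrier ?C" for s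
    using \<Lambda>[OF that] by (simp add: Z.tends_def)
  have lin\<Lambda>: "lin_map ?C Z \<Lambda>"
    unfolding lin_map_def
    using \<Lambda>_closed \<Lambda> cauchy by (auto simp: C_simps Vf intro!: \<Lambda>I add smult)
  \<comment> \<open>As a kernel, the null sequences form a submodule; the same equation gives the
    injectivity of the induced map \<open>T\<close> below.\<close>
  have null: "null_seqs V = {s \<in> carrier ?C. \<Lambda> s = \<zero>\<^bsub>Z\<^esub>}"
  proof -
    have "(\<lambda>n. mnorm V (s n)) \<longlonglongrightarrow> 0 \<longleftrightarrow> \<Lambda> s = \<zero>\<^bsub>Z\<^esub>" if s: "s \<in> carrier ?C" for s
    proof -
      have sV: "\<forall>n. s n \<in> carrier V"
        using s by (simp add: cauchy)
      then have "(\<lambda>n. mnorm V (s n)) \<longlonglongrightarrow> 0 \<longleftrightarrow> Z.tends (\<lambda>n. L (s n)) \<zero>\<^bsub>Z\<^esub>"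
        using Z.tends_zero_iff[of "\<lambda>n. L (s n)"] LD(1) iso by simp
      then show ?thesis
        using \<Lambda>I[OF sV] \<Lambda>[OF s] by metis
    qed
    then show ?thesis
      unfolding null_seqs_def by (auto simp: cauchy_module_def)
  qed
  interpret Q: quotient_module ?C "null_seqs V"
    unfolding quotient_module_def using C submodule_kernel[OF C Zmod lin\<Lambda>] null by simp
  obtain T where linT: "lin_map (quot_module ?C (null_seqs V)) Z T"
    and T: "\<And>s. s \<in> carrier ?C \<Longrightarrow> T (null_seqs V +>\<^bsub>?C\<^esub> s) = \<Lambda> s"
    using Q.quotient_lift[OF Zmod lin\<Lambda>] null by blast
  \<comment> \<open>Approximating \<open>z\<close> within \<open>inverse (Suc n)\<close> by
    \<open>L (s n)\<close> yields a sequence \<open>s\<close> whose image tends to \<open>z\<close>;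
    this alone makes \<open>s\<close> Cauchy in \<open>V\<close>.\<close>
  have surj: "\<exists>s\<in>carrier ?C. \<Lambda> s = z" if z: "z \<in> carrier Z" for z
  proof -
    have "\<exists>v. v \<in> carrier V \<and> mnorm Z (L v \<ominus>\<^bsub>Z\<^esub> z) < inverse (real (Suc n))" for n
      using dense[OF z, of "inverse (real (Suc n))"] by (auto simp del: of_nat_Suc)
    then obtain s where s: "\<And>n. s n \<in> carrier V" "\<And>n. mnorm Z (L (s n) \<ominus>\<^bsub>Z\<^esub> z) < inverse (real (Suc n))"
      by metis
    have "(\<lambda>n. mnorm Z (L (s n) \<ominus>\<^bsub>Z\<^esub> z)) \<longlonglongrightarrow> 0"
    proof (rule tendsto_sandwich[OF _ _ tendsto_const LIMSEQ_inverse_real_of_nat])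
      show "\<forall>\<^sub>F n in sequentially. 0 \<le> mnorm Z (L (s n) \<ominus>\<^bsub>Z\<^esub> z)"
        using LD(1) s z by (auto intro!: always_eventually Z.norm_nonneg)
    qed (use s(2) in \<open>auto intro!: always_eventually less_imp_le\<close>)
    then have "Z.tends (\<lambda>n. L (s n)) z"
      using z by (simp add: Z.tends_def)
    then show ?thesis
      using s(1) \<Lambda>I[of s z] cauchy by blast
  qed
  have carr: "carrier (completion V) = {null_seqs V +>\<^bsub>?C\<^esub> s |s. s \<in> carrier ?C}"
    by (simp add: completion_def Q.carrier_quot)
  have "bij_betw T (carrier (completion V)) (carrier Z)"
  proof (rule bij_betw_imageI)
    show "inj_on T (carrier (completion V))"
    proof (rule inj_onI)
      fix A B assume "A \<in> carrier (completion V)" "B \<in> carrier (completion V)" and eq: "T A = T B"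
      then obtain s t where st: "s \<in> carrier ?C" "t \<in> carrier ?C"
        and AB: "A = null_seqs V +>\<^bsub>?C\<^esub> s" "B = null_seqs V +>\<^bsub>?C\<^esub> t"
        by (auto simp: carr)
      have "\<Lambda> (s \<ominus>\<^bsub>?C\<^esub> t) = \<zero>\<^bsub>Z\<^esub>"
        using eq st \<Lambda>_closed[OF st(2)] T lin_map_minus[OF C Zmod lin\<Lambda> st]
        by (simp add: AB a_minus_def Z.M.r_neg)
      then show "A = B"
        unfolding AB using Q.coset_eq_iff[OF st] null C.M.minus_closed[OF st] by blast
    qed
    show "T ` carrier (completion V) = carrier Z"
    proof
      show "T ` carrier (completion V) \<subseteq> carrier Z"
        using T \<Lambda>_closed by (auto simp: carr)
      show "carrier Z \<subseteq> T ` carrier (completion V)"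
        using surj T unfolding carr by (force intro: rev_image_eqI)
    qed
  qed
  moreover have "mnorm Z (T A) = mnorm (completion V) A" if A_in: "A \<in> carrier (completion V)" for A
  proof -
    obtain s where s: "s \<in> carrier ?C" and A: "A = null_seqs V +>\<^bsub>?C\<^esub> s"
      using A_in by (auto simp: carr)
    \<comment> \<open>The norms along any representative tend to the same number, so the definite
      description in the norm of the completion has a value. Its uniqueness uses that
      \<open>A\<close> contains the representative \<open>s\<close>.\<close>
    have lim: "(\<lambda>n. mnorm V (t n)) \<longlonglongrightarrow> mnorm Z (T A)" if t: "t \<in> A" for t
    proof -
      have tC: "t \<in> carrier ?C"
        using t s A Q.a_elemrcos_carrier by blast
      have "T A = \<Lambda> t"
        using T[OF tC] Q.a_repr_independence'[of t s] t s A by simp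
      then show ?thesis
        using Z.tends_norm[OF _ \<Lambda>[OF tC]] tC LD(1) iso by (simp add: cauchy)
    qed
    have "mnorm (completion V) A = (THE l. \<forall>s\<in>A. (\<lambda>n. mnorm V (s n)) \<longlonglongrightarrow> l)"
      by (simp add: completion_def)
    also have "\<dots> = mnorm Z (T A)"
    proof (rule the_equality)
      fix l assume "\<forall>s\<in>A. (\<lambda>n. mnorm V (s n)) \<longlonglongrightarrow> l"
      then have "(\<lambda>n. mnorm V (s n)) \<longlonglongrightarrow> l" "(\<lambda>n. mnorm V (s n)) \<longlonglongrightarrow> mnorm Z (T A)"
        using lim Q.a_rcos_self[OF s] A by auto
      then show "l = mnorm Z (T A)"
        by (rule LIMSEQ_unique)
    qed (use lim in blast)
    finally show ?thesis ..
  qed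
  ultimately have "isometric_iso (completion V) Z T"
    using linT by (simp add: isometric_iso_def completion_def)
  moreover have "T (completion_embed V v) = L v" if "v \<in> carrier V" for v
    using T[OF const(1)[OF that]] \<Lambda>I[of "\<lambda>n. v"] const(2)[OF that] that
    by (simp add: completion_embed_def)
  ultimately show thesis
    using that by blast
qed

section \<open>Spaces of continuous functions\<close>

lemma continuous_on_restrict_iff [simp]: "continuous_on S (restrict f S) \<longleftrightarrow> continuous_on S f"
  by (rule continuous_on_cong) auto

lemma cont_module_simps:
  "carrier (cont_module S scl) = {f \<in> extensional S. continuous_on S f}"
  "\<zero>\<^bsub>cont_module S scl\<^esub> = (\<lambda>w\<in>S. 0)"
  "f \<oplus>\<^bsub>cont_module S scl\<^esub> g = (\<lambda>w\<in>S. f w + g w)"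
  "c \<odot>\<^bsub>cont_module S scl\<^esub> f = (\<lambda>w\<in>S. scl c (f w))"
  by (simp_all add: cont_module_def)

lemma module_cont_module:
  assumes "\<And>c f. continuous_on S f \<Longrightarrow> continuous_on S (\<lambda>w. scl c (f w))"
    and "\<And>c d v. scl (c + d) v = scl c v + scl d v" "\<And>c u v. scl c (u + v) = scl c u + scl c v"
    and "\<And>c d v. scl (c * d) v = scl c (scl d v)" "\<And>v. scl 1 v = v" "\<And>v. scl 0 v = 0"
  shows "module complex_field (cont_module S scl)"
  by (rule module_complexI)
    (auto simp: cont_module_simps assms fun_eq_iff restrict_def[of _ S] extensional_def algebra_simps
      intro!: continuous_on_add continuous_on_const assms(1)
      simp flip: restrict_def[of _ S])

text \<open>The bound \<open>b\<close> makes the set bounded above, so its \<open>Sup\<close> is a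
  genuine least upper bound. The inserted 0 turns into the conjunct \<open>0 \<le> B\<close>, which
  settles the case of an empty \<open>S\<close>.\<close>

lemma Sup_insert_zero_le_iff:
  fixes g :: "'a \<Rightarrow> real"
  assumes "\<And>w. w \<in> S \<Longrightarrow> g w \<le> b"
  shows "Sup (insert 0 (g ` S)) \<le> B \<longleftrightarrow> 0 \<le> B \<and> (\<forall>w\<in>S. g w \<le> B)"
proof -
  have "bdd_above (insert 0 (g ` S))"
    unfolding bdd_above_insert by (rule bdd_aboveI2) (rule assms)
  then show ?thesis
    by (subst cSup_le_iff) auto
qed

lemma continuous_on_compact_norm_bound:
  assumes "compact S" "continuous_on S f"
  obtains b where "\<And>w. w \<in> S \<Longrightarrow> norm (f w) \<le> b"
  using compact_imp_bounded[OF compact_continuous_image[OF assms(2,1)]]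
  by (auto simp: bounded_iff)

section \<open>Continuous vector-valued functions\<close>

lemma cont_vec_simps:
  fixes f :: "complex \<Rightarrow> complex ^ 'd::finite"
  shows "carrier (cont_vec M :: (complex \<Rightarrow> complex ^ 'd) normed_module) = {f \<in> extensional M. continuous_on M f}"
    and "\<zero>\<^bsub>cont_vec M\<^esub> = (\<lambda>w\<in>M. 0 :: complex ^ 'd)"
    and "f \<oplus>\<^bsub>cont_vec M\<^esub> g = (\<lambda>w\<in>M. f w + g w)"
    and "c \<odot>\<^bsub>cont_vec M\<^esub> f = (\<lambda>w\<in>M. c *s f w)"
  by (simp_all add: cont_vec_def cont_module_simps)

lemma module_cont_vec:
  "module complex_field (cont_vec M :: (complex \<Rightarrow> complex ^ 'd::finite) normed_module)"
  unfolding cont_vec_def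
proof (intro module_with_norm module_cont_module)
  fix c and f :: "complex \<Rightarrow> complex ^ 'd"
  assume "continuous_on M f"
  then show "continuous_on M (\<lambda>w. c *s f w)"
    unfolding vector_scalar_mult_def by (intro continuous_intros)
qed (simp_all add: vec_eq_iff algebra_simps)

text \<open>The norm is used only through its upper bounds. Taking the norm itself for
  \<open>B\<close> gives its nonnegativity and the bound on the entries. Continuity on the compact
  \<open>M\<close> supplies the boundedness that the supremum requires.\<close>

lemma cont_vec_norm_le_iff:
  assumes "compact M" and x: "x \<in> carrier (cont_vec M :: (complex \<Rightarrow> complex ^ 'd::finite) normed_module)"
  shows "mnorm (cont_vec M) x \<le> B \<longleftrightarrow> 0 \<le> B \<and> (\<forall>w\<in>M. \<forall>j. cmod (x w $ j) \<le> B)"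
proof -
  obtain b where b: "\<And>w. w \<in> M \<Longrightarrow> norm (x w) \<le> b"
    using continuous_on_compact_norm_bound[OF assms(1)] x unfolding cont_vec_simps by blast
  have "cmod (x w $ j) \<le> b" if "w \<in> M" for w j
    using b[OF that] Finite_Cartesian_Product.norm_nth_le[of "x w" j] by linarith
  then have b': "(MAX j\<in>UNIV. cmod (x w $ j)) \<le> b" if "w \<in> M" for w
    using that by simp
  then show ?thesis
    unfolding cont_vec_def by (simp add: Sup_insert_zero_le_iff[OF b'])
qed

section \<open>Continuous matrix-valued functions\<close>

lemma cont_mat_simps:
  fixes f :: "complex \<times> complex \<Rightarrow> complex ^ 'd2::finite ^ 'd1::finite"
  shows "carrier (cont_mat M1 M2 :: (complex \<times> complex \<Rightarrow> complex ^ 'd2 ^ 'd1) normed_module) =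
      {f \<in> extensional (M1 \<times> M2). continuous_on (M1 \<times> M2) f}"
    and "\<zero>\<^bsub>cont_mat M1 M2\<^esub> = (\<lambda>w\<in>M1 \<times> M2. 0 :: complex ^ 'd2 ^ 'd1)"
    and "f \<oplus>\<^bsub>cont_mat M1 M2\<^esub> g = (\<lambda>w\<in>M1 \<times> M2. f w + g w)"
    and "c \<odot>\<^bsub>cont_mat M1 M2\<^esub> f = (\<lambda>w\<in>M1 \<times> M2. \<chi> j k. c * f w $ j $ k)"
  by (simp_all add: cont_mat_def cont_module_simps)

lemma module_cont_mat:
  "module complex_field (cont_mat M1 M2 :: (complex \<times> complex \<Rightarrow> complex ^ 'd2::finite ^ 'd1::finite) normed_module)"
  unfolding cont_mat_def
proof (intro module_with_norm module_cont_module)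
  fix c and f :: "complex \<times> complex \<Rightarrow> complex ^ 'd2 ^ 'd1"
  assume "continuous_on (M1 \<times> M2) f"
  then show "continuous_on (M1 \<times> M2) (\<lambda>w. \<chi> j k. c * f w $ j $ k)"
    by (intro continuous_intros)
qed (simp_all add: vec_eq_iff algebra_simps)

lemma cont_mat_minus:
  fixes f :: "complex \<times> complex \<Rightarrow> complex ^ 'd2::finite ^ 'd1::finite"
  assumes "f \<in> carrier (cont_mat M1 M2)" "g \<in> carrier (cont_mat M1 M2)"
  shows "f \<ominus>\<^bsub>cont_mat M1 M2\<^esub> g = (\<lambda>w\<in>M1 \<times> M2. f w - g w)"
  using assms module_uminus[OF module_cont_mat assms(2)]
  by (auto simp: a_minus_def cont_mat_simps fun_eq_iff vec_eq_iff restrict_def[of _ "M1 \<times> M2"])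

lemma cont_mat_norm_le_iff:
  assumes "compact M1" "compact M2"
    and f: "f \<in> carrier (cont_mat M1 M2 :: (complex \<times> complex \<Rightarrow> complex ^ 'd2::finite ^ 'd1::finite) normed_module)"
  shows "mnorm (cont_mat M1 M2) f \<le> B \<longleftrightarrow> 0 \<le> B \<and> (\<forall>w\<in>M1 \<times> M2. \<forall>j k. cmod (f w $ j $ k) \<le> B)"
proof -
  obtain b where b: "\<And>w. w \<in> M1 \<times> M2 \<Longrightarrow> norm (f w) \<le> b"
    using continuous_on_compact_norm_bound[OF compact_Times[OF assms(1,2)]] f
    unfolding cont_mat_simps by blast
  have b': "cmod (f w $ j $ k) \<le> b" if "w \<in> M1 \<times> M2" for w j k
    using b[OF that] Finite_Cartesian_Product.norm_nth_le[of "f w" j] Finite_Cartesian_Product.norm_nth_le[of "f w $ j" k] by linarith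
  have "mnorm (cont_mat M1 M2) f \<le> B \<longleftrightarrow>
      (\<forall>j k. Sup (insert 0 ((\<lambda>w. cmod (f w $ j $ k)) ` (M1 \<times> M2))) \<le> B)"
    unfolding cont_mat_def by simp
  also have "\<dots> \<longleftrightarrow> 0 \<le> B \<and> (\<forall>w\<in>M1 \<times> M2. \<forall>j k. cmod (f w $ j $ k) \<le> B)"
    by (subst Sup_insert_zero_le_iff[OF b']) auto
  finally show ?thesis .
qed

text \<open>The norm laws are checked entrywise. For completeness, the entries of a Cauchy sequence
  are uniformly Cauchy, and their uniform limits are continuous and form the limit matrix.\<close>

lemma complex_banach_cont_mat:
  assumes "compact M1" "compact M2"
  shows "complex_banach (cont_mat M1 M2 :: (complex \<times> complex \<Rightarrow> complex ^ 'd2::finite ^ 'd1::finite) normed_module)"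
    (is "complex_banach ?Z")
proof -
  interpret module complex_field ?Z
    by (rule module_cont_mat)
  let ?S = "M1 \<times> M2"
  note le_iff = cont_mat_norm_le_iff[OF assms]
  have entry: "cmod (f w $ j $ k) \<le> mnorm ?Z f" if "f \<in> carrier ?Z" "w \<in> ?S" for f w j k
    using le_iff[OF that(1), of "mnorm ?Z f"] that(2) by blast
  have nonneg: "0 \<le> mnorm ?Z f" if "f \<in> carrier ?Z" for f
    using le_iff[OF that, of "mnorm ?Z f"] by blast
  \<comment> \<open>One half of homogeneity. The other half, for \<open>c \<noteq> 0\<close>, is
    this inequality applied to \<open>inverse c\<close> and \<open>c \<odot> f\<close>.\<close>
  have smult_le: "mnorm ?Z (c \<odot>\<^bsub>?Z\<^esub> f) \<le> cmod c * mnorm ?Z f" if f: "f \<in> carrier ?Z" for c f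
    using f nonneg[OF f] entry[OF f] smult_closed[of c f]
    by (subst le_iff) (auto simp: cont_mat_simps norm_mult mult_left_mono)
  show ?thesis
  proof
    fix f assume f: "f \<in> carrier ?Z"
    show "mnorm ?Z f = 0 \<Longrightarrow> f = \<zero>\<^bsub>?Z\<^esub>"
      using entry[OF f] f by (auto simp: cont_mat_simps fun_eq_iff vec_eq_iff extensional_def)
    show "mnorm ?Z (c \<odot>\<^bsub>?Z\<^esub> f) = cmod c * mnorm ?Z f" for c
    proof (cases "c = 0")
      case True
      then show ?thesis
        using smult_le[OF f, of 0] nonneg[of "0 \<odot>\<^bsub>?Z\<^esub> f"] smult_closed[of 0 f] f by simp
    next
      case False
      have "f = inverse c \<odot>\<^bsub>?Z\<^esub> (c \<odot>\<^bsub>?Z\<^esub> f)"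
        using False f smult_assoc1[of "inverse c" c f] smult_one[of f] by simp
      then have "mnorm ?Z f \<le> cmod (inverse c) * mnorm ?Z (c \<odot>\<^bsub>?Z\<^esub> f)"
        using smult_le[of "c \<odot>\<^bsub>?Z\<^esub> f" "inverse c"] smult_closed[of c f] f by simp
      then show ?thesis
        using False smult_le[OF f, of c] by (simp add: norm_inverse norm_divide field_simps)
    qed
    fix g assume g: "g \<in> carrier ?Z"
    have "f \<oplus>\<^bsub>?Z\<^esub> g \<in> carrier ?Z"
      using f g by simp
    moreover have "cmod (f w $ j $ k + g w $ j $ k) \<le> mnorm ?Z f + mnorm ?Z g" if "w \<in> ?S" for w j k
      using norm_triangle_ineq[of "f w $ j $ k" "g w $ j $ k"] entry[OF f that, of j k] entry[OF g that, of j k]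
      by linarith
    ultimately show "mnorm ?Z (f \<oplus>\<^bsub>?Z\<^esub> g) \<le> mnorm ?Z f + mnorm ?Z g"
      using nonneg[OF f] nonneg[OF g] by (subst le_iff) (auto simp: cont_mat_simps)
  next
    fix s :: "nat \<Rightarrow> complex \<times> complex \<Rightarrow> complex ^ 'd2 ^ 'd1"
    assume s: "\<And>n. s n \<in> carrier ?Z"
      and cauchy: "\<And>e. e > 0 \<Longrightarrow> \<exists>N. \<forall>m\<ge>N. \<forall>n\<ge>N. mnorm ?Z (s m \<ominus>\<^bsub>?Z\<^esub> s n) < e"
    have "\<exists>l. uniform_limit ?S (\<lambda>n w. s n w $ j $ k) l sequentially" for j k
    proof -
      have "uniformly_Cauchy_on ?S (\<lambda>n w. s n w $ j $ k)"
      proof (rule uniformly_Cauchy_onI)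
        fix e :: real assume "e > 0"
        then obtain N where N: "\<And>m n. m \<ge> N \<Longrightarrow> n \<ge> N \<Longrightarrow> mnorm ?Z (s m \<ominus>\<^bsub>?Z\<^esub> s n) < e"
          using cauchy by blast
        have "dist (s m w $ j $ k) (s n w $ j $ k) < e" if "w \<in> ?S" "m \<ge> N" "n \<ge> N" for m n w
          using entry[OF M.minus_closed[OF s s] that(1), of m n j k] N[OF that(2,3)] that(1)
          by (simp add: cont_mat_minus[OF s s] dist_norm)
        then show "\<exists>N. \<forall>w\<in>?S. \<forall>m\<ge>N. \<forall>n\<ge>N. dist (s m w $ j $ k) (s n w $ j $ k) < e"
          by blast
      qed
      then show ?thesis
        by (simp add: uniformly_convergent_on_def flip: uniformly_convergent_eq_Cauchy)
    qed
    then obtain l where l: "\<And>j k. uniform_limit ?S (\<lambda>n w. s n w $ j $ k) (l j k) sequentially"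
      by metis
    define z where "z = (\<lambda>w\<in>?S. \<chi> j k. l j k w)"
    have z_entry: "z w $ j $ k = l j k w" if "w \<in> ?S" for w j k
      using that by (simp add: z_def)
    have "continuous_on ?S (l j k)" for j k
      by (rule uniform_limit_theorem[OF _ l])
        (use s in \<open>auto simp: cont_mat_simps intro!: always_eventually continuous_on_component\<close>)
    then have z: "z \<in> carrier ?Z"
      by (auto simp: z_def cont_mat_simps intro!: continuous_intros)
    have "(\<lambda>n. mnorm ?Z (s n \<ominus>\<^bsub>?Z\<^esub> z)) \<longlonglongrightarrow> 0"
    proof (rule tendstoI)
      fix e :: real assume e: "e > 0"
      have "\<forall>\<^sub>F n in sequentially. \<forall>j k. \<forall>w\<in>?S. dist (s n w $ j $ k) (l j k w) < e / 2"
        using e by (intro eventually_all_finite uniform_limitD[OF l]) simp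
      then show "\<forall>\<^sub>F n in sequentially. dist (mnorm ?Z (s n \<ominus>\<^bsub>?Z\<^esub> z)) 0 < e"
      proof eventually_elim
        case (elim n)
        \<comment> \<open>The entrywise bounds give only a non-strict bound on the norm, hence
          \<open>e / 2\<close>. They hold simultaneously for large \<open>n\<close> because there
          are finitely many entries.\<close>
        have "mnorm ?Z (s n \<ominus>\<^bsub>?Z\<^esub> z) \<le> e / 2"
          using elim e
          by (subst le_iff[OF M.minus_closed[OF s z]])
            (auto simp: cont_mat_minus[OF s z] z_entry dist_norm less_imp_le)
        then show ?case
          using e nonneg[OF M.minus_closed[OF s z], of n] by simp
      qed
    qed
    with z show "\<exists>z\<in>carrier ?Z. (\<lambda>n. mnorm ?Z (s n \<ominus>\<^bsub>?Z\<^esub> z)) \<longlonglongrightarrow> 0"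
      by blast
  qed
qed

section \<open>Algebraic tensor products\<close>

lemma free_module_simps:
  "carrier (free_module S) = {r. Poly_Mapping.keys r \<subseteq> S}" "\<zero>\<^bsub>free_module S\<^esub> = 0"
  "r \<oplus>\<^bsub>free_module S\<^esub> s = r + s" "c \<odot>\<^bsub>free_module S\<^esub> r = Poly_Mapping.map ((*) c) r"
  by (simp_all add: free_module_def)

lemma lookup_map_times [simp]:
  "Poly_Mapping.lookup (Poly_Mapping.map ((*) c) r) k = (c :: complex) * Poly_Mapping.lookup r k"
  by (simp add: Poly_Mapping.map.rep_eq when_def)

lemma keys_subset_iff: "Poly_Mapping.keys r \<subseteq> S \<longleftrightarrow> (\<forall>k. k \<notin> S \<longrightarrow> Poly_Mapping.lookup r k = 0)"
  by (auto simp: in_keys_iff)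

lemma module_free_module: "module complex_field (free_module S)"
  by (rule module_complexI)
    (auto simp: free_module_simps keys_subset_iff lookup_add algebra_simps intro!: poly_mapping_eqI)

lemma free_module_minus:
  assumes "r \<in> carrier (free_module S)" "s \<in> carrier (free_module S)"
  shows "r \<ominus>\<^bsub>free_module S\<^esub> s = r - s"
  using module_uminus[OF module_free_module assms(2)]
  by (auto simp: a_minus_def free_module_simps lookup_add lookup_minus intro!: poly_mapping_eqI)

text \<open>The linear functional on the free module that takes the value \<open>h k\<close> at the
  basis element \<open>k\<close>.\<close>

definition free_ext :: "('a \<Rightarrow> complex) \<Rightarrow> ('a \<Rightarrow>\<^sub>0 complex) \<Rightarrow> complex" where
  "free_ext h r = (\<Sum>k\<in>Poly_Mapping.keys r. Poly_Mapping.lookup r k * h k)"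

text \<open>A common finite index set allows elements with different supports to be compared and
  added.\<close>

lemma free_ext_superset:
  assumes "finite A" "Poly_Mapping.keys r \<subseteq> A"
  shows "free_ext h r = (\<Sum>k\<in>A. Poly_Mapping.lookup r k * h k)"
  unfolding free_ext_def by (rule sum.mono_neutral_left) (use assms in \<open>auto simp: in_keys_iff\<close>)

lemma free_ext_add: "free_ext h (r + s) = free_ext h r + free_ext h s"
proof -
  let ?A = "Poly_Mapping.keys r \<union> Poly_Mapping.keys s"
  have "free_ext h t = (\<Sum>k\<in>?A. Poly_Mapping.lookup t k * h k)" if "t \<in> {r, s, r + s}" for t
    by (rule free_ext_superset) (use that keys_add[of r s] in auto)
  then show ?thesis
    by (simp add: lookup_add distrib_right sum.distrib)
qed

lemma free_ext_diff: "free_ext h (r - s) = free_ext h r - free_ext h s"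
  using free_ext_add[of h "r - s" s] by simp

lemma free_ext_smult: "free_ext h (Poly_Mapping.map ((*) c) r) = c * free_ext h r"
proof -
  have "free_ext h (Poly_Mapping.map ((*) c) r) =
      (\<Sum>k\<in>Poly_Mapping.keys r. Poly_Mapping.lookup (Poly_Mapping.map ((*) c) r) k * h k)"
    by (rule free_ext_superset) (auto simp: in_keys_iff)
  then show ?thesis
    by (simp add: free_ext_def sum_distrib_left mult.assoc)
qed

lemma free_ext_single [simp]: "free_ext h (Poly_Mapping.single k c) = c * h k"
  by (simp add: free_ext_def)

section \<open>Pure tensors as generators of the tensor product\<close>

locale tensor_modules =
  X: module complex_field X + Y: module complex_field Y
  for X :: "(complex, 'a, 'm) module_scheme" and Y :: "(complex, 'b, 'n) module_scheme"
begin

abbreviation F where "F \<equiv> free_module (carrier X \<times> carrier Y)"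

lemma single_closed [simp]: "x \<in> carrier X \<Longrightarrow> y \<in> carrier Y \<Longrightarrow> Poly_Mapping.single (x, y) c \<in> carrier F"
  by (simp add: free_module_simps)

lemma bilinear_relations_subset: "bilinear_relations X Y \<subseteq> carrier F"
proof -
  interpret F: module complex_field F
    by (rule module_free_module)
  have "r - s \<in> carrier F" if "r \<in> carrier F" "s \<in> carrier F" for r s
    using F.M.minus_closed[OF that] free_module_minus[OF that] by simp
  then show ?thesis
    using X.smult_closed Y.smult_closed by (auto simp: bilinear_relations_def)
qed

text \<open>The hull is the intersection of all submodules that contain the relations. The whole
  free module is one of them, so the intersection lies in the free module, and the closure
  properties pass to it.\<close>

lemma submodule_tensor_null: "submodule (tensor_null X Y) complex_field F"
proof -
  interpret F: module complex_field F
    by (rule module_free_module)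
  let ?T = "{N. submodule N complex_field F \<and> bilinear_relations X Y \<subseteq> N}"
  have "carrier F \<in> ?T"
    using F.carrier_is_submodule bilinear_relations_subset by simp
  then have "\<Inter>?T \<subseteq> carrier F"
    by blast
  moreover have "\<zero>\<^bsub>F\<^esub> \<in> N" if "submodule N complex_field F" for N
    using that submodule.axioms(1) subgroup.one_closed by fastforce
  ultimately show ?thesis
    unfolding tensor_null_def hull_def
    by (intro F.submoduleI) (use F.submoduleE in \<open>auto\<close>)
qed

sublocale Q: quotient_module F "tensor_null X Y"
  unfolding quotient_module_def using module_free_module submodule_tensor_null by blast

lemma module_alg_tensor: "module complex_field (alg_tensor X Y)"
  unfolding alg_tensor_def by (rule Q.module_quot)

sublocale T: module complex_field "alg_tensor X Y"
  by (rule module_alg_tensor)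

lemma pure_tensor_closed [simp]:
  "x \<in> carrier X \<Longrightarrow> y \<in> carrier Y \<Longrightarrow> pure_tensor X Y x y \<in> carrier (alg_tensor X Y)"
  unfolding alg_tensor_def Q.carrier_quot pure_tensor_def by auto

text \<open>A coefficient in the free module can be absorbed into the left factor, so sums of pure
  tensors without coefficients exhaust the tensor product.\<close>

lemma pure_tensor_smult:
  assumes "x \<in> carrier X" "y \<in> carrier Y"
  shows "pure_tensor X Y (c \<odot>\<^bsub>X\<^esub> x) y = tensor_null X Y +>\<^bsub>F\<^esub> Poly_Mapping.single (x, y) c"
proof -
  have cx: "c \<odot>\<^bsub>X\<^esub> x \<in> carrier X"
    using assms X.smult_closed by simp
  have "Poly_Mapping.single (c \<odot>\<^bsub>X\<^esub> x, y) 1 - Poly_Mapping.single (x, y) c \<in> bilinear_relations X Y"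
    using assms unfolding bilinear_relations_def by blast
  then have "Poly_Mapping.single (c \<odot>\<^bsub>X\<^esub> x, y) 1 - Poly_Mapping.single (x, y) c \<in> tensor_null X Y"
    unfolding tensor_null_def by (rule hull_inc)
  then show ?thesis
    unfolding pure_tensor_def using assms cx by (simp add: Q.coset_eq_iff free_module_minus)
qed

text \<open>Induction over a finite set containing the support of a representative in the free
  module: each step removes one basis element together with its coefficient, and the coset of that
  term is again a pure tensor.\<close>

lemma alg_tensor_induct [consumes 1, case_names zero add]:
  assumes u: "u \<in> carrier (alg_tensor X Y)"
    and zero: "P \<zero>\<^bsub>alg_tensor X Y\<^esub>"
    and add: "\<And>u x y. u \<in> carrier (alg_tensor X Y) \<Longrightarrow> x \<in> carrier X \<Longrightarrow> y \<in> carrier Y \<Longrightarrow> P u \<Longrightarrow>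
      P (u \<oplus>\<^bsub>alg_tensor X Y\<^esub> pure_tensor X Y x y)"
  shows "P u"
proof -
  let ?co = "\<lambda>r. tensor_null X Y +>\<^bsub>F\<^esub> r"
  have *: "P (?co r)" if "finite A" "A \<subseteq> carrier X \<times> carrier Y" "Poly_Mapping.keys r \<subseteq> A" for A r
    using that
  proof (induction A arbitrary: r rule: finite_induct)
    case empty
    then have "r = \<zero>\<^bsub>F\<^esub>"
      by (simp add: free_module_simps)
    then show ?case
      using zero by (simp only: alg_tensor_def Q.zero_quot)
  next
    case (insert a A)
    obtain x y where a: "a = (x, y)" and xy: "x \<in> carrier X" "y \<in> carrier Y"
      using insert.prems(1) by auto
    define c where "c = Poly_Mapping.lookup r a"
    define r' where "r' = r - Poly_Mapping.single a c"
    have "Poly_Mapping.keys r' \<subseteq> A"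
      using insert.prems(2) by (auto simp: r'_def c_def in_keys_iff lookup_minus lookup_single when_def split: if_splits)
    then have r': "P (?co r')" "r' \<in> carrier F"
      using insert by (auto simp: free_module_simps)
    have "?co r = ?co r' \<oplus>\<^bsub>alg_tensor X Y\<^esub> ?co (Poly_Mapping.single a c)"
      using r'(2) xy a Q.add_quot[of r' "Poly_Mapping.single a c"]
      by (simp add: alg_tensor_def free_module_simps r'_def)
    moreover have "?co r' \<in> carrier (alg_tensor X Y)"
      using r'(2) by (auto simp: alg_tensor_def Q.carrier_quot)
    moreover have "c \<odot>\<^bsub>X\<^esub> x \<in> carrier X"
      using xy X.smult_closed by simp
    ultimately show ?case
      using add[of "?co r'" "c \<odot>\<^bsub>X\<^esub> x" y] r'(1) xy by (simp add: pure_tensor_smult a)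
  qed
  obtain r where "u = ?co r" "Poly_Mapping.keys r \<subseteq> carrier X \<times> carrier Y"
    using u unfolding alg_tensor_def Q.carrier_quot free_module_simps by blast
  then show ?thesis
    using *[of "Poly_Mapping.keys r" r] by simp
qed

lemma lin_map_alg_tensor_unique:
  assumes Z: "module complex_field Z"
    and L: "lin_map (alg_tensor X Y) Z L" "lin_map (alg_tensor X Y) Z L'"
    and eq: "\<And>x y. x \<in> carrier X \<Longrightarrow> y \<in> carrier Y \<Longrightarrow> L (pure_tensor X Y x y) = L' (pure_tensor X Y x y)"
    and u: "u \<in> carrier (alg_tensor X Y)"
  shows "L u = L' u"
  using u
proof (induction u rule: alg_tensor_induct)
  case zero
  then show ?case
    using lin_map_zero[OF module_alg_tensor Z L(1)] lin_map_zero[OF module_alg_tensor Z L(2)] by simp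
next
  case (add u x y)
  then show ?case
    using lin_mapD(2)[OF L(1)] lin_mapD(2)[OF L(2)] eq by simp
qed

lemma finsum_pure_Suc:
  assumes "x \<in> {..<Suc n} \<rightarrow> carrier X" "y \<in> {..<Suc n} \<rightarrow> carrier Y"
  shows "finsum (alg_tensor X Y) (\<lambda>i. pure_tensor X Y (x i) (y i)) {..<Suc n} =
    finsum (alg_tensor X Y) (\<lambda>i. pure_tensor X Y (x i) (y i)) {..<n} \<oplus>\<^bsub>alg_tensor X Y\<^esub> pure_tensor X Y (x n) (y n)"
proof -
  have "(\<lambda>i. pure_tensor X Y (x i) (y i)) \<in> {..<n} \<rightarrow> carrier (alg_tensor X Y)"
    "pure_tensor X Y (x n) (y n) \<in> carrier (alg_tensor X Y)"
    using assms by (auto simp: Pi_iff)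
  then show ?thesis
    unfolding lessThan_Suc by (subst T.M.finsum_insert) (auto intro!: T.M.a_comm T.M.finsum_closed)
qed

text \<open>Provides a representation of \<open>u\<close> over which the supremum in the injective
  norm can be evaluated.\<close>

lemma alg_tensor_representation:
  assumes "u \<in> carrier (alg_tensor X Y)"
  shows "\<exists>(n::nat) x y. x \<in> {..<n} \<rightarrow> carrier X \<and> y \<in> {..<n} \<rightarrow> carrier Y \<and>
    u = finsum (alg_tensor X Y) (\<lambda>i. pure_tensor X Y (x i) (y i)) {..<n}"
  using assms
proof (induction u rule: alg_tensor_induct)
  case zero
  show ?case
    by (rule exI[of _ 0]) auto
next
  case (add u a b)
  then obtain n :: nat and x y where xy: "x \<in> {..<n} \<rightarrow> carrier X" "y \<in> {..<n} \<rightarrow> carrier Y"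
    and u: "u = finsum (alg_tensor X Y) (\<lambda>i. pure_tensor X Y (x i) (y i)) {..<n}"
    by blast
  let ?x = "x(n := a)" and ?y = "y(n := b)"
  have xy': "?x \<in> {..<Suc n} \<rightarrow> carrier X" "?y \<in> {..<Suc n} \<rightarrow> carrier Y"
    using xy add.hyps by (auto simp: Pi_iff less_Suc_eq)
  have "u = finsum (alg_tensor X Y) (\<lambda>i. pure_tensor X Y (?x i) (?y i)) {..<n}"
    unfolding u using xy by (intro T.M.finsum_cong') (auto simp: Pi_iff)
  then have "u \<oplus>\<^bsub>alg_tensor X Y\<^esub> pure_tensor X Y a b =
      finsum (alg_tensor X Y) (\<lambda>i. pure_tensor X Y (?x i) (?y i)) {..<Suc n}"
    using finsum_pure_Suc[OF xy'] by simp
  then show ?case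
    using xy' by blast
qed

end

section \<open>The injective norm\<close>

lemma tensor_modules_cont_vec:
  "tensor_modules (cont_vec M1 :: (complex \<Rightarrow> complex ^ 'd1::finite) normed_module)
    (cont_vec M2 :: (complex \<Rightarrow> complex ^ 'd2::finite) normed_module)"
  by (intro tensor_modules.intro module_cont_vec)

section \<open>The canonical map into matrix functions\<close>

lemma continuous_on_tensor_fun:
  fixes x :: "complex \<Rightarrow> complex ^ 'd1::finite" and y :: "complex \<Rightarrow> complex ^ 'd2::finite"
  assumes "continuous_on M1 x" "continuous_on M2 y"
  shows "continuous_on (M1 \<times> M2) (\<lambda>w. x (fst w) $ j * y (snd w) $ k)"
proof -
  have "continuous_on (M1 \<times> M2) (\<lambda>w. x (fst w))"
    by (rule continuous_on_compose2[OF assms(1)]) (auto intro: continuous_intros)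
  moreover have "continuous_on (M1 \<times> M2) (\<lambda>w. y (snd w))"
    by (rule continuous_on_compose2[OF assms(2)]) (auto intro: continuous_intros)
  ultimately show ?thesis
    by (intro continuous_intros)
qed

text \<open>For each point and each entry, the product \<open>f w1 $ j * g w2 $ k\<close> is
  bilinear in \<open>f\<close> and \<open>g\<close>, so its linear extension to the free module
  vanishes on the bilinearity relations. The kernel of the resulting map \<open>L0\<close> is a
  submodule and hence contains \<open>tensor_null\<close>.\<close>

lemma tensor_fun_lift:
  fixes M1 M2 :: "complex set"
  defines "X \<equiv> cont_vec M1 :: (complex \<Rightarrow> complex ^ 'd1::finite) normed_module"
    and "Y \<equiv> cont_vec M2 :: (complex \<Rightarrow> complex ^ 'd2::finite) normed_module"
    and "Z \<equiv> cont_mat M1 M2 :: (complex \<times> complex \<Rightarrow> complex ^ 'd2 ^ 'd1) normed_module"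
  obtains L where "lin_map (alg_tensor X Y) Z L"
    and "\<forall>f\<in>carrier X. \<forall>g\<in>carrier Y. L (pure_tensor X Y f g) = tensor_fun M1 M2 f g"
proof -
  interpret tensor_modules X Y
    unfolding X_def Y_def by (rule tensor_modules_cont_vec)
  have Z: "module complex_field Z"
    unfolding Z_def by (rule module_cont_mat)
  interpret Z: module complex_field Z
    by (rule Z)
  let ?S = "M1 \<times> M2"
  define E where "E w j k r = free_ext (\<lambda>p. fst p (fst w) $ j * snd p (snd w) $ k) r"
    for w j k and r :: "(complex \<Rightarrow> complex ^ 'd1) \<times> (complex \<Rightarrow> complex ^ 'd2) \<Rightarrow>\<^sub>0 complex"
  define L0 :: "_ \<Rightarrow> _ \<Rightarrow> complex ^ 'd2 ^ 'd1" where "L0 r = (\<lambda>w\<in>?S. \<chi> j k. E w j k r)" for r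
  have cont: "continuous_on ?S (\<lambda>w. E w j k r)" if "r \<in> carrier F" for j k r
    unfolding E_def free_ext_def
  proof (rule continuous_on_sum, rule continuous_on_mult[OF continuous_on_const])
    fix p assume "p \<in> Poly_Mapping.keys r"
    then have "p \<in> carrier X \<times> carrier Y"
      using that by (auto simp: free_module_simps)
    then show "continuous_on ?S (\<lambda>w. fst p (fst w) $ j * snd p (snd w) $ k)"
      by (intro continuous_on_tensor_fun) (auto simp: X_def Y_def cont_vec_simps)
  qed
  have lin: "lin_map F Z L0"
    unfolding lin_map_def Z_def cont_mat_simps free_module_simps L0_def
    using cont[unfolded free_module_simps]
    by (auto simp: fun_eq_iff vec_eq_iff E_def free_ext_add free_ext_smult intro!: continuous_intros)
  have ker: "submodule {r \<in> carrier F. L0 r = \<zero>\<^bsub>Z\<^esub>} complex_field F"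
    by (rule submodule_kernel[OF module_free_module Z lin])
  have zero: "L0 r = \<zero>\<^bsub>Z\<^esub>" if "\<And>w j k. w \<in> ?S \<Longrightarrow> E w j k r = 0" for r
    using that by (auto simp: L0_def Z_def cont_mat_simps fun_eq_iff vec_eq_iff)
  have "L0 r = \<zero>\<^bsub>Z\<^esub>" if "r \<in> bilinear_relations X Y" for r
    using that unfolding bilinear_relations_def
    by (intro zero)
      (auto simp: E_def free_ext_diff X_def Y_def cont_vec_simps distrib_left distrib_right
        mult.assoc mult.left_commute)
  then have "tensor_null X Y \<subseteq> {r \<in> carrier F. L0 r = \<zero>\<^bsub>Z\<^esub>}"
    unfolding tensor_null_def using bilinear_relations_subset by (intro hull_minimal ker) auto
  then obtain L where L: "lin_map (alg_tensor X Y) Z L"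
    "\<And>r. r \<in> carrier F \<Longrightarrow> L (tensor_null X Y +>\<^bsub>F\<^esub> r) = L0 r"
    using Q.quotient_lift[OF Z lin] unfolding alg_tensor_def by blast
  moreover have "L (pure_tensor X Y f g) = tensor_fun M1 M2 f g" if "f \<in> carrier X" "g \<in> carrier Y" for f g
    using L(2)[OF single_closed[OF that]] unfolding pure_tensor_def
    by (auto simp: L0_def E_def tensor_fun_def fun_eq_iff vec_eq_iff)
  ultimately show thesis
    using that by blast
qed

text \<open>Connects abstract sums of pure tensors with entries of functions: the right-hand side is
  the sum in the injective norm when both functionals are point evaluations.\<close>

lemma lin_map_finsum_pure:
  fixes M1 M2 :: "complex set"
  defines "X \<equiv> cont_vec M1 :: (complex \<Rightarrow> complex ^ 'd1::finite) normed_module"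
    and "Y \<equiv> cont_vec M2 :: (complex \<Rightarrow> complex ^ 'd2::finite) normed_module"
    and "Z \<equiv> cont_mat M1 M2 :: (complex \<times> complex \<Rightarrow> complex ^ 'd2 ^ 'd1) normed_module"
  assumes L: "lin_map (alg_tensor X Y) Z L"
    and pure: "\<forall>f\<in>carrier X. \<forall>g\<in>carrier Y. L (pure_tensor X Y f g) = tensor_fun M1 M2 f g"
    and "x \<in> {..<n::nat} \<rightarrow> carrier X" "y \<in> {..<n} \<rightarrow> carrier Y" "w1 \<in> M1" "w2 \<in> M2"
  shows "L (finsum (alg_tensor X Y) (\<lambda>i. pure_tensor X Y (x i) (y i)) {..<n}) (w1, w2) $ j $ k =
    (\<Sum>i<n. x i w1 $ j * y i w2 $ k)"
  using assms(6,7)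
proof (induction n)
  interpret tensor_modules X Y
    unfolding X_def Y_def by (rule tensor_modules_cont_vec)
  have Z: "module complex_field Z"
    unfolding Z_def by (rule module_cont_mat)
  {
    case 0
    then show ?case
      using lin_map_zero[OF module_alg_tensor Z L] assms(8,9) by (simp add: Z_def cont_mat_simps)
  next
    case (Suc n)
    have xy: "x \<in> {..<n} \<rightarrow> carrier X" "y \<in> {..<n} \<rightarrow> carrier Y" "x n \<in> carrier X" "y n \<in> carrier Y"
      using Suc.prems by (auto simp: Pi_iff)
    have "finsum (alg_tensor X Y) (\<lambda>i. pure_tensor X Y (x i) (y i)) {..<n} \<in> carrier (alg_tensor X Y)"
      using xy by (intro T.M.finsum_closed) (auto simp: Pi_iff)
    then show ?case
      using Suc.IH[OF xy(1,2)] assms(8,9) lin_mapD(2)[OF L] pure xy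
      by (simp add: finsum_pure_Suc[OF Suc.prems]) (simp add: Z_def cont_mat_simps tensor_fun_def)
  }
qed

section \<open>Functionals on spaces of continuous functions\<close>

lemma cont_vec_lincomb:
  fixes x :: "nat \<Rightarrow> complex \<Rightarrow> complex ^ 'd::finite"
  assumes "x \<in> {..<n} \<rightarrow> carrier (cont_vec M)"
  shows "(\<lambda>w\<in>M. \<chi> j. \<Sum>i<n. c i * x i w $ j) \<in> carrier (cont_vec M)" (is "?v n \<in> _")
    and "lin_map (cont_vec M) complex_field \<phi> \<Longrightarrow>
      \<phi> (\<lambda>w\<in>M. \<chi> j. \<Sum>i<n. c i * x i w $ j) = (\<Sum>i<n. c i * \<phi> (x i))"
proof -
  have closed: "?v m \<in> carrier (cont_vec M)" if "m \<le> n" for m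
  proof -
    have "continuous_on M (x i)" if "i < m" for i
      using assms \<open>m \<le> n\<close> that by (auto simp: cont_vec_simps Pi_iff)
    then have "continuous_on M (\<lambda>w. \<chi> j. \<Sum>i<m. c i * x i w $ j)"
      by (auto intro!: continuous_intros)
    then show ?thesis
      unfolding cont_vec_simps by (intro CollectI conjI restrict_extensional continuous_on_restrict_iff[THEN iffD2])
  qed
  show "?v n \<in> carrier (cont_vec M)"
    by (rule closed) simp
  interpret X: module complex_field "cont_vec M :: (complex \<Rightarrow> complex ^ 'd) normed_module"
    by (rule module_cont_vec)
  interpret C: module complex_field complex_field
    by (rule module_complexI) (auto simp: algebra_simps)
  assume \<phi>: "lin_map (cont_vec M) complex_field \<phi>"
  \<comment> \<open>The induction runs over \<open>m \<le> n\<close>, so that the hypothesis on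
    \<open>x\<close> for indices below \<open>n\<close> stays fixed.\<close>
  have "\<phi> (?v m) = (\<Sum>i<m. c i * \<phi> (x i))" if "m \<le> n" for m
    using that
  proof (induction m)
    case 0
    have "?v 0 = \<zero>\<^bsub>cont_vec M\<^esub>"
      by (simp add: cont_vec_simps vec_eq_iff fun_eq_iff)
    then show ?case
      using lin_map_zero[OF X.module_axioms C.module_axioms \<phi>] by simp
  next
    case (Suc m)
    have xm: "x m \<in> carrier (cont_vec M)"
      using assms Suc.prems by (auto simp: Pi_iff)
    have "?v (Suc m) = ?v m \<oplus>\<^bsub>cont_vec M\<^esub> (c m \<odot>\<^bsub>cont_vec M\<^esub> x m)"
      by (auto simp: cont_vec_simps vec_eq_iff fun_eq_iff)
    then show ?case
      using Suc closed[of m] lin_mapD(2,3)[OF \<phi>] xm X.smult_closed[of "c m" "x m"] by simp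
  qed
  then show "\<phi> (?v n) = (\<Sum>i<n. c i * \<phi> (x i))"
    by simp
qed

text \<open>The dual norm is a supremum over the unit ball, so \<open>x\<close> is first scaled to
  norm 1. If \<open>x\<close> has norm 0, the bound with \<open>K\<close> already forces
  \<open>\<phi> x = 0\<close>.\<close>

lemma dual_norm_bound:
  fixes x :: "complex \<Rightarrow> complex ^ 'd::finite"
  assumes M: "compact M" and \<phi>: "\<phi> \<in> dual (cont_vec M)" "dual_norm (cont_vec M) \<phi> \<le> 1"
    and x: "x \<in> carrier (cont_vec M)"
  shows "cmod (\<phi> x) \<le> mnorm (cont_vec M) x"
proof -
  let ?X = "cont_vec M :: (complex \<Rightarrow> complex ^ 'd) normed_module"
  interpret X: module complex_field ?X
    by (rule module_cont_vec)
  note le_iff = cont_vec_norm_le_iff[OF M]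
  obtain K where lin: "lin_map ?X complex_field \<phi>" and K: "\<And>x. x \<in> carrier ?X \<Longrightarrow> cmod (\<phi> x) \<le> K * mnorm ?X x"
    using \<phi>(1) by (auto simp: dual_def)
  have nonneg: "0 \<le> mnorm ?X x" if "x \<in> carrier ?X" for x
    using le_iff[OF that, of "mnorm ?X x"] by blast
  show ?thesis
  proof (cases "mnorm ?X x = 0")
    case True
    then show ?thesis
      using K[OF x] by simp
  next
    case False
    define a where "a = mnorm ?X x"
    have a: "a > 0"
      using False nonneg[OF x] by (simp add: a_def)
    define y where "y = complex_of_real (1 / a) \<odot>\<^bsub>?X\<^esub> x"
    have y: "y \<in> carrier ?X"
      using x X.smult_closed by (simp add: y_def)
    have "cmod (x w $ j) \<le> a" if "w \<in> M" for w j
      using le_iff[OF x, of a] that by (simp add: a_def)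
    then have "mnorm ?X y \<le> 1"
      using a by (subst le_iff[OF y]) (auto simp: y_def cont_vec_simps norm_mult norm_divide divide_simps)
    then have "cmod (\<phi> y) \<in> {cmod (\<phi> x) |x. x \<in> carrier ?X \<and> mnorm ?X x \<le> 1}"
      using y by blast
    \<comment> \<open>Boundedness of the functional ensures that the supremum in
      \<open>dual_norm\<close> really dominates the values on the unit ball.\<close>
    moreover have "bdd_above {cmod (\<phi> x) |x. x \<in> carrier ?X \<and> mnorm ?X x \<le> 1}"
    proof (rule bdd_aboveI)
      fix r assume "r \<in> {cmod (\<phi> x) |x. x \<in> carrier ?X \<and> mnorm ?X x \<le> 1}"
      then obtain x where x: "x \<in> carrier ?X" "mnorm ?X x \<le> 1" "r = cmod (\<phi> x)"
        by blast
      have "r \<le> K * mnorm ?X x"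
        using K x by simp
      \<comment> \<open>The constant \<open>K\<close> may be negative, hence the absolute
        value.\<close>
      also have "\<dots> \<le> \<bar>K\<bar> * 1"
        using nonneg[OF x(1)] x(2) by (intro mult_mono) auto
      finally show "r \<le> \<bar>K\<bar>"
        by simp
    qed
    ultimately have "cmod (\<phi> y) \<le> 1"
      using \<phi>(2) unfolding dual_norm_def by (meson cSup_upper order_trans)
    moreover have "\<phi> y = complex_of_real (1 / a) * \<phi> x"
      using lin_mapD(3)[OF lin x] by (simp add: y_def)
    ultimately show ?thesis
      using a by (simp add: norm_mult norm_divide a_def[symmetric] divide_simps)
  qed
qed

text \<open>Each entry of \<open>x\<close> is bounded by the norm of \<open>x\<close>. These
  functionals yield the lower bound for the injective norm.\<close>

lemma point_evaluation_dual:
  fixes M :: "complex set" and j :: "'d::finite"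
  assumes M: "compact M" and w: "w \<in> M"
  shows "(\<lambda>x. x w $ j) \<in> dual (cont_vec M)" and "dual_norm (cont_vec M) (\<lambda>x. x w $ j) \<le> 1"
proof -
  let ?X = "cont_vec M :: (complex \<Rightarrow> complex ^ 'd) normed_module"
  interpret X: module complex_field ?X
    by (rule module_cont_vec)
  have bound: "cmod (x w $ j) \<le> mnorm ?X x" if "x \<in> carrier ?X" for x
    using cont_vec_norm_le_iff[OF M that, of "mnorm ?X x"] w by blast
  show "(\<lambda>x. x w $ j) \<in> dual ?X"
    using w bound unfolding dual_def lin_map_def by (auto simp: cont_vec_simps intro!: exI[of _ 1])
  have "mnorm ?X \<zero>\<^bsub>?X\<^esub> \<le> 1"
    by (subst cont_vec_norm_le_iff[OF M X.M.zero_closed]) (simp add: cont_vec_simps)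
  then show "dual_norm ?X (\<lambda>x. x w $ j) \<le> 1"
    unfolding dual_norm_def
    using X.M.zero_closed bound by (intro cSup_least) (auto intro: order_trans)
qed

text \<open>Puts 0 into the set whose supremum is the injective norm. This set is then nonempty with
  a nonnegative supremum even if \<open>M1\<close> or \<open>M2\<close> is empty, where there are no
  point evaluations.\<close>

lemma zero_dual:
  assumes M: "compact M"
  shows "(\<lambda>_. 0) \<in> dual (cont_vec M :: (complex \<Rightarrow> complex ^ 'd::finite) normed_module)" (is "_ \<in> dual ?X")
    and "dual_norm (cont_vec M :: (complex \<Rightarrow> complex ^ 'd::finite) normed_module) (\<lambda>_. 0) \<le> 1"
proof -
  interpret X: module complex_field ?X
    by (rule module_cont_vec)
  show "(\<lambda>_. 0) \<in> dual ?X"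
    unfolding dual_def lin_map_def by (auto intro!: exI[of _ 0])
  have "mnorm ?X \<zero>\<^bsub>?X\<^esub> \<le> 1"
    by (subst cont_vec_norm_le_iff[OF M X.M.zero_closed]) (simp add: cont_vec_simps)
  then show "dual_norm ?X (\<lambda>_. 0) \<le> 1"
    unfolding dual_norm_def using X.M.zero_closed by (intro cSup_least) auto
qed

lemma injective_norm_eq:
  fixes M1 M2 :: "complex set"
  defines "X \<equiv> cont_vec M1 :: (complex \<Rightarrow> complex ^ 'd1::finite) normed_module"
    and "Y \<equiv> cont_vec M2 :: (complex \<Rightarrow> complex ^ 'd2::finite) normed_module"
    and "Z \<equiv> cont_mat M1 M2 :: (complex \<times> complex \<Rightarrow> complex ^ 'd2 ^ 'd1) normed_module"
  assumes M: "compact M1" "compact M2"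
    and L: "lin_map (alg_tensor X Y) Z L"
    and pure: "\<forall>f\<in>carrier X. \<forall>g\<in>carrier Y. L (pure_tensor X Y f g) = tensor_fun M1 M2 f g"
    and u: "u \<in> carrier (alg_tensor X Y)"
  shows "injective_norm X Y u = mnorm Z (L u)"
proof -
  interpret tensor_modules X Y
    unfolding X_def Y_def by (rule tensor_modules_cont_vec)
  have Lu: "L u \<in> carrier Z"
    using lin_mapD(1)[OF L u] .
  note Z_le_iff = cont_mat_norm_le_iff[OF M Lu[unfolded Z_def], folded Z_def]
  define B where "B = mnorm Z (L u)"
  have B: "0 \<le> B" "\<And>w1 w2 j k. w1 \<in> M1 \<Longrightarrow> w2 \<in> M2 \<Longrightarrow> cmod (L u (w1, w2) $ j $ k) \<le> B"
    using Z_le_iff[of B] unfolding B_def by auto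
  note entry = lin_map_finsum_pure[OF L[unfolded X_def Y_def Z_def] pure[unfolded X_def Y_def], folded X_def Y_def]
  let ?A = "{cmod (\<Sum>i<n. \<phi> (x i) * \<psi> (y i)) | (n::nat) x y \<phi> \<psi>.
            x \<in> {..<n} \<rightarrow> carrier X \<and> y \<in> {..<n} \<rightarrow> carrier Y \<and>
            u = finsum (alg_tensor X Y) (\<lambda>i. pure_tensor X Y (x i) (y i)) {..<n} \<and>
            \<phi> \<in> dual X \<and> \<psi> \<in> dual Y \<and> dual_norm X \<phi> \<le> 1 \<and> dual_norm Y \<psi> \<le> 1}"
  have upper: "cmod (\<Sum>i<n. \<phi> (x i) * \<psi> (y i)) \<le> B"
    if x: "x \<in> {..<n} \<rightarrow> carrier X" and y: "y \<in> {..<n} \<rightarrow> carrier Y"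
      and u_eq: "u = finsum (alg_tensor X Y) (\<lambda>i. pure_tensor X Y (x i) (y i)) {..<n}"
      and \<phi>: "\<phi> \<in> dual X" "dual_norm X \<phi> \<le> 1" and \<psi>: "\<psi> \<in> dual Y" "dual_norm Y \<psi> \<le> 1"
    for n :: nat and x y \<phi> \<psi>
  proof -
    have lin: "lin_map X complex_field \<phi>" "lin_map Y complex_field \<psi>"
      using \<phi> \<psi> by (auto simp: dual_def)
    \<comment> \<open>With \<open>w\<close> and \<open>j\<close> fixed, the sum is
      \<open>\<psi>\<close> applied to a vector function of \<open>w2\<close> whose entries are
      those in row \<open>j\<close> of \<open>L u\<close> at \<open>(w, w2)\<close>, all bounded by
      \<open>B\<close>.\<close>
    have inner: "cmod (\<Sum>i<n. \<psi> (y i) * x i w $ j) \<le> B" if w: "w \<in> M1" for w j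
    proof -
      let ?v = "\<lambda>w2\<in>M2. \<chi> k. \<Sum>i<n. x i w $ j * y i w2 $ k"
      note v = cont_vec_lincomb[OF y[unfolded Y_def], where c = "\<lambda>i. x i w $ j", folded Y_def]
      have bound: "cmod (\<Sum>i<n. x i w $ j * y i w2 $ k) \<le> B" if "w2 \<in> M2" for w2 k
        using B(2)[OF w that, of j k] entry[OF x y w that, of j k] by (simp add: u_eq)
      have "cmod (\<Sum>i<n. \<psi> (y i) * x i w $ j) = cmod (\<psi> ?v)"
        using v(2)[OF lin(2)] by (simp add: mult.commute)
      also have "\<dots> \<le> mnorm Y ?v"
        unfolding Y_def by (rule dual_norm_bound[OF M(2) \<psi>[unfolded Y_def] v(1)[unfolded Y_def]])
      also have "\<dots> \<le> B"
        unfolding Y_def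
        using B(1) bound by (subst cont_vec_norm_le_iff[OF M(2) v(1)[unfolded Y_def]]) simp
      finally show ?thesis .
    qed
    let ?v = "\<lambda>w\<in>M1. \<chi> j. \<Sum>i<n. \<psi> (y i) * x i w $ j"
    note v = cont_vec_lincomb[OF x[unfolded X_def], where c = "\<lambda>i. \<psi> (y i)", folded X_def]
    \<comment> \<open>Now the numbers \<open>\<psi> (y i)\<close> serve as coefficients and
      \<open>\<phi>\<close> is moved out of the sum; \<open>inner\<close> bounds every entry of the
      vector function it is applied to.\<close>
    have "cmod (\<Sum>i<n. \<phi> (x i) * \<psi> (y i)) = cmod (\<phi> ?v)"
      using v(2)[OF lin(1)] by (simp add: mult.commute)
    also have "\<dots> \<le> mnorm X ?v"
      unfolding X_def by (rule dual_norm_bound[OF M(1) \<phi>[unfolded X_def] v(1)[unfolded X_def]])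
    also have "\<dots> \<le> B"
      unfolding X_def
      using B(1) inner by (subst cont_vec_norm_le_iff[OF M(1) v(1)[unfolded X_def]]) simp
    finally show ?thesis .
  qed
  then have le: "\<And>a. a \<in> ?A \<Longrightarrow> a \<le> B"
    by blast
  then have bdd: "bdd_above ?A"
    by (rule bdd_aboveI)
  obtain n :: nat and x y where x: "x \<in> {..<n} \<rightarrow> carrier X" and y: "y \<in> {..<n} \<rightarrow> carrier Y"
    and u_eq: "u = finsum (alg_tensor X Y) (\<lambda>i. pure_tensor X Y (x i) (y i)) {..<n}"
    using alg_tensor_representation[OF u] by blast
  have mem: "cmod (\<Sum>i<n. \<phi> (x i) * \<psi> (y i)) \<in> ?A"
    if "\<phi> \<in> dual X" "\<psi> \<in> dual Y" "dual_norm X \<phi> \<le> 1" "dual_norm Y \<psi> \<le> 1" for \<phi> \<psi>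
    using x y u_eq that by blast
  have zero: "(\<lambda>_. 0) \<in> dual X" "dual_norm X (\<lambda>_. 0) \<le> 1" "(\<lambda>_. 0) \<in> dual Y" "dual_norm Y (\<lambda>_. 0) \<le> 1"
    unfolding X_def Y_def using zero_dual[OF M(1)] zero_dual[OF M(2)] by blast+
  have nonempty: "0 \<in> ?A"
    using mem[OF zero(1,3,2,4)] by simp
  have "B \<le> Sup ?A"
    unfolding B_def
  proof (subst Z_le_iff, intro conjI ballI allI)
    show "0 \<le> Sup ?A"
      using bdd nonempty by (rule cSup_upper[rotated])
    fix w j k assume "w \<in> M1 \<times> M2"
    then obtain w1 w2 where w: "w = (w1, w2)" "w1 \<in> M1" "w2 \<in> M2"
      by blast
    \<comment> \<open>Taking point evaluations for both functionals, the sum becomes the entry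
      \<open>(j, k)\<close> of \<open>L u\<close> at \<open>w\<close>.\<close>
    have "cmod (\<Sum>i<n. x i w1 $ j * y i w2 $ k) \<in> ?A"
      by (rule mem) (use point_evaluation_dual[OF M(1) w(2)] point_evaluation_dual[OF M(2) w(3)] in
        \<open>auto simp: X_def Y_def\<close>)
    then have "cmod (\<Sum>i<n. x i w1 $ j * y i w2 $ k) \<le> Sup ?A"
      using bdd by (rule cSup_upper)
    then show "cmod (L u w $ j $ k) \<le> Sup ?A"
      using entry[OF x y w(2,3)] by (simp add: w u_eq)
  qed
  moreover have "Sup ?A \<le> B"
    by (rule cSup_least[OF _ le]) (use nonempty in blast)
  ultimately show ?thesis
    unfolding injective_norm_def B_def by (intro antisym)
qed

section \<open>Density of separable functions\<close>

text \<open>Finite sums of products of a continuous function of the first variable and one of the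
  second. The factors are continuous on the whole plane, so the notion does not depend on
  \<open>M1\<close> and \<open>M2\<close>.\<close>

inductive separable :: "(complex \<times> complex \<Rightarrow> complex) \<Rightarrow> bool" where
  prod: "continuous_on UNIV a \<Longrightarrow> continuous_on UNIV b \<Longrightarrow> separable (\<lambda>w. a (fst w) * b (snd w))"
| add: "separable f \<Longrightarrow> separable g \<Longrightarrow> separable (\<lambda>w. f w + g w)"

text \<open>A product of two products regroups by variable,
  \<open>(a b) (c d) = (a c) (b d)\<close>; sums are handled by distributivity in each
  factor.\<close>

lemma separable_mult:
  assumes "separable f" "separable g"
  shows "separable (\<lambda>w. f w * g w)"
  using assms(1)
proof induction
  case (prod a b)
  note ab = prod
  show ?case
    using assms(2)
  proof induction
    case (prod c d)
    have "separable (\<lambda>w. (a (fst w) * c (fst w)) * (b (snd w) * d (snd w)))"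
      by (rule separable.prod[of "\<lambda>z. a z * c z" "\<lambda>z. b z * d z"]) (intro continuous_intros ab prod)+
    then show ?case
      by (simp add: mult_ac)
  next
    case (add f g)
    then show ?case
      using separable.add by (simp add: distrib_left)
  qed
next
  case (add f h)
  then show ?case
    using separable.add by (simp add: distrib_right)
qed

lemma separable_const: "separable (\<lambda>w. c)"
  using separable.prod[of "\<lambda>_. c" "\<lambda>_. 1"] by simp

text \<open>Only the linear case has content: additivity gives
  \<open>f w = f (fst w, 0) + f (0, snd w)\<close>, a sum of two functions of one variable
  each.\<close>

lemma separable_real_polynomial:
  assumes "real_polynomial_function (p :: complex \<times> complex \<Rightarrow> real)"
  shows "separable (\<lambda>w. complex_of_real (p w))"
  using assms
proof induction
  case (linear f)
  then have "continuous_on UNIV f"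
    by (rule linear_continuous_on)
  then have "continuous_on UNIV (\<lambda>z. f (z, 0))" "continuous_on UNIV (\<lambda>z. f (0, z))"
    by (auto intro!: continuous_on_compose2[where g = f and t = UNIV] continuous_intros)
  then have sep: "separable (\<lambda>w. complex_of_real (f (fst w, 0)) * 1 + 1 * complex_of_real (f (0, snd w)))"
    by (intro separable.add separable.prod[of "\<lambda>z. complex_of_real (f (z, 0))" "\<lambda>_. 1"]
        separable.prod[of "\<lambda>_. 1" "\<lambda>z. complex_of_real (f (0, z))"])
      (auto intro!: continuous_intros)
  have split: "f (fst w, 0) + f (0, snd w) = f w" for w
    using bounded_linear.linear[OF linear, THEN linear_add, of "(fst w, 0)" "(0, snd w)"] by simp
  have eq: "(\<lambda>w. complex_of_real (f w)) =
      (\<lambda>w. complex_of_real (f (fst w, 0)) * 1 + 1 * complex_of_real (f (0, snd w)))"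
    by (rule ext) (simp add: split flip: of_real_add)
  show ?case
    unfolding eq by (rule sep)
next
  case (add f g)
  then show ?case
    using separable.add by simp
next
  case (mult f g)
  then show ?case
    using separable_mult by simp
qed (simp add: separable_const)

text \<open>Stone-Weierstrass gives a polynomial map \<open>g\<close> near \<open>f\<close>. Its
  real and imaginary parts are real polynomials, hence separable, and \<open>g\<close> is recombined
  from them.\<close>

lemma separable_dense:
  fixes f :: "complex \<times> complex \<Rightarrow> complex"
  assumes "compact S" "continuous_on S f" "e > 0"
  obtains h where "separable h" "\<And>w. w \<in> S \<Longrightarrow> cmod (h w - f w) < e"
proof -
  obtain g where g: "polynomial_function g" "\<forall>w\<in>S. norm (f w - g w) < e"
    using Stone_Weierstrass_polynomial_function[OF assms] by blast
  have "real_polynomial_function (\<lambda>w. Re (g w))" "real_polynomial_function (\<lambda>w. Im (g w))"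
    using g(1) bounded_linear_Re bounded_linear_Im by (auto simp: polynomial_function_def o_def)
  then have "separable (\<lambda>w. of_real (Re (g w)) + \<i> * of_real (Im (g w)))"
    by (intro separable.add separable_mult separable_const separable_real_polynomial)
  then have "separable g"
    by (simp add: complex_eq[symmetric])
  then show thesis
    using that g(2) by (simp add: norm_minus_commute)
qed

text \<open>Each entry of \<open>z\<close> is approximated by a separable function. A separable
  function placed in a single entry, with zeros elsewhere, lies in the range of \<open>L\<close>,
  and the approximating matrix is the sum of these over all entries.\<close>

lemma tensor_fun_dense:
  fixes M1 M2 :: "complex set"
  defines "X \<equiv> cont_vec M1 :: (complex \<Rightarrow> complex ^ 'd1::finite) normed_module"
    and "Y \<equiv> cont_vec M2 :: (complex \<Rightarrow> complex ^ 'd2::finite) normed_module"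
    and "Z \<equiv> cont_mat M1 M2 :: (complex \<times> complex \<Rightarrow> complex ^ 'd2 ^ 'd1) normed_module"
  assumes M: "compact M1" "compact M2"
    and L: "lin_map (alg_tensor X Y) Z L"
    and pure: "\<forall>f\<in>carrier X. \<forall>g\<in>carrier Y. L (pure_tensor X Y f g) = tensor_fun M1 M2 f g"
    and z: "z \<in> carrier Z" and e: "e > 0"
  shows "\<exists>u\<in>carrier (alg_tensor X Y). mnorm Z (L u \<ominus>\<^bsub>Z\<^esub> z) < e"
proof -
  interpret tensor_modules X Y
    unfolding X_def Y_def by (rule tensor_modules_cont_vec)
  have Z: "module complex_field Z"
    unfolding Z_def by (rule module_cont_mat)
  interpret Z: module complex_field Z
    by (rule Z)
  let ?S = "M1 \<times> M2"
  define R where "R f \<longleftrightarrow> restrict f ?S \<in> L ` carrier (alg_tensor X Y)" for f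
  have R_add: "R (\<lambda>w. f w + g w)" if "R f" "R g" for f g
  proof -
    obtain u v where uv: "u \<in> carrier (alg_tensor X Y)" "v \<in> carrier (alg_tensor X Y)"
      "restrict f ?S = L u" "restrict g ?S = L v"
      using \<open>R f\<close> \<open>R g\<close> unfolding R_def by blast
    have "(\<lambda>w\<in>?S. f w + g w) = restrict f ?S \<oplus>\<^bsub>Z\<^esub> restrict g ?S"
      by (auto simp: Z_def cont_mat_simps fun_eq_iff)
    then have "(\<lambda>w\<in>?S. f w + g w) = L (u \<oplus>\<^bsub>alg_tensor X Y\<^esub> v)"
      using uv lin_mapD(2)[OF L] by simp
    then show ?thesis
      unfolding R_def using uv T.M.a_closed by blast
  qed
  have R_zero: "R (\<lambda>w. 0)"
    unfolding R_def using lin_map_zero[OF module_alg_tensor Z L] T.M.zero_closed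
    by (auto simp: Z_def cont_mat_simps intro!: rev_image_eqI)
  have R_sum: "R (\<lambda>w. \<Sum>i\<in>I. f i w)" if "finite I" "\<And>i. R (f i)" for I and f :: "'i \<Rightarrow> _"
    using that(1) by induction (auto intro!: R_zero R_add that(2))
  have R_entry: "R (\<lambda>w. \<chi> j' k'. if j' = j \<and> k' = k then h w else 0)" if "separable h" for h j k
    using that
  proof induction
    case (prod a b)
    \<comment> \<open>Multiples of coordinate vectors: the product of their entries vanishes except
      at \<open>(j, k)\<close>, so one pure tensor realises a matrix function with a single nonzero
      entry.\<close>
    define f :: "complex \<Rightarrow> complex ^ 'd1" where "f = (\<lambda>w\<in>M1. a w *s axis j 1)"
    define g :: "complex \<Rightarrow> complex ^ 'd2" where "g = (\<lambda>w\<in>M2. b w *s axis k 1)"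
    have "continuous_on M1 a" "continuous_on M2 b"
      using prod continuous_on_subset by blast+
    then have fg: "f \<in> carrier X" "g \<in> carrier Y"
      unfolding f_def g_def X_def Y_def cont_vec_simps vector_scalar_mult_def
      by (auto intro!: continuous_intros)
    have "restrict (\<lambda>w. \<chi> j' k'. if j' = j \<and> k' = k then a (fst w) * b (snd w) else 0) ?S = tensor_fun M1 M2 f g"
      by (auto simp: fun_eq_iff vec_eq_iff tensor_fun_def f_def g_def axis_def)
    also have "tensor_fun M1 M2 f g = L (pure_tensor X Y f g)"
      using pure fg by simp
    finally show ?case
      unfolding R_def using pure_tensor_closed[OF fg] by (rule image_eqI)
  next
    case (add f g)
    have "(\<lambda>w. \<chi> j' k'. if j' = j \<and> k' = k then f w + g w else 0) =
        (\<lambda>w. (\<chi> j' k'. if j' = j \<and> k' = k then f w else 0) + (\<chi> j' k'. if j' = j \<and> k' = k then g w else 0))"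
      by (auto simp: fun_eq_iff vec_eq_iff)
    then show ?case
      using R_add[OF add.IH] by simp
  qed
  have "\<exists>h. separable h \<and> (\<forall>w\<in>?S. cmod (h w - z w $ j $ k) < e / 2)" for j k
  proof -
    have "continuous_on ?S (\<lambda>w. z w $ j $ k)"
      using z by (auto simp: Z_def cont_mat_simps intro!: continuous_intros)
    then show ?thesis
      using separable_dense[OF compact_Times[OF M], of "\<lambda>w. z w $ j $ k" "e / 2"] e by (metis half_gt_zero)
  qed
  then obtain h where h: "\<And>j k. separable (h j k)" "\<And>j k w. w \<in> ?S \<Longrightarrow> cmod (h j k w - z w $ j $ k) < e / 2"
    by metis
  define f where "f w = (\<Sum>j\<in>UNIV. \<Sum>k\<in>UNIV. \<chi> j' k'. if j' = j \<and> k' = k then h j k w else 0)" for w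
  have f_entry: "f w $ j $ k = h j k w" for w j k
  proof -
    have "f w $ j $ k = (\<Sum>j'\<in>UNIV. \<Sum>k'\<in>UNIV. if j = j' \<and> k = k' then h j' k' w else 0)"
      by (simp add: f_def)
    also have "\<dots> = (\<Sum>j'\<in>UNIV. if j = j' then (\<Sum>k'\<in>UNIV. if k = k' then h j' k' w else 0) else 0)"
      by (rule sum.cong) auto
    also have "\<dots> = h j k w"
      by simp
    finally show ?thesis .
  qed
  have "R f"
    unfolding f_def by (intro R_sum R_entry h) auto
  then obtain u where u: "u \<in> carrier (alg_tensor X Y)" "L u = restrict f ?S"
    unfolding R_def by auto
  have Lu: "L u \<in> carrier Z"
    using lin_mapD(1)[OF L u(1)] .
  have "mnorm Z (L u \<ominus>\<^bsub>Z\<^esub> z) \<le> e / 2"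
    using cont_mat_norm_le_iff[OF M Z.M.minus_closed[OF Lu z, unfolded Z_def], folded Z_def, of "e / 2"]
      cont_mat_minus[OF Lu[unfolded Z_def] z[unfolded Z_def], folded Z_def] e h(2)
    by (auto simp: u(2) f_entry less_imp_le)
  then show ?thesis
    using u(1) e by (intro bexI[of _ u]) auto
qed

section \<open>Extension of the canonical map to the completed tensor product\<close>

theorem theorem3p1:
  fixes M1 M2 :: "complex set"
  assumes "compact M1" and "compact M2"
  shows "let X = (cont_vec M1 :: (complex \<Rightarrow> complex ^ 'd1::finite) normed_module);
             Y = (cont_vec M2 :: (complex \<Rightarrow> complex ^ 'd2::finite) normed_module);
             Z = (cont_mat M1 M2 :: (complex \<times> complex \<Rightarrow> complex ^ 'd2 ^ 'd1) normed_module)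
         in \<exists>L. lin_map (alg_tensor X Y) Z L \<and>
                (\<forall>f\<in>carrier X. \<forall>g\<in>carrier Y. L (pure_tensor X Y f g) = tensor_fun M1 M2 f g) \<and>
                (\<forall>L'. lin_map (alg_tensor X Y) Z L' \<and>
                      (\<forall>f\<in>carrier X. \<forall>g\<in>carrier Y.
                         L' (pure_tensor X Y f g) = tensor_fun M1 M2 f g) \<longrightarrow>
                      (\<forall>u\<in>carrier (alg_tensor X Y). L' u = L u)) \<and>
                (\<exists>T. isometric_iso (injective_tensor X Y) Z T \<and>
                     (\<forall>u\<in>carrier (alg_tensor X Y).
                        T (completion_embed (alg_tensor_injective X Y) u) = L u))"
proof -
  define X where "X = (cont_vec M1 :: (complex \<Rightarrow> complex ^ 'd1) normed_module)"
  define Y where "Y = (cont_vec M2 :: (complex \<Rightarrow> complex ^ 'd2) normed_module)"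
  define Z where "Z = (cont_mat M1 M2 :: (complex \<times> complex \<Rightarrow> complex ^ 'd2 ^ 'd1) normed_module)"
  interpret tensor_modules X Y
    unfolding X_def Y_def by (rule tensor_modules_cont_vec)
  have Z: "complex_banach Z"
    unfolding Z_def by (rule complex_banach_cont_mat[OF assms])
  obtain L where L: "lin_map (alg_tensor X Y) Z L"
    and pure: "\<forall>f\<in>carrier X. \<forall>g\<in>carrier Y. L (pure_tensor X Y f g) = tensor_fun M1 M2 f g"
    using tensor_fun_lift unfolding X_def Y_def Z_def by blast
  have unique: "L' u = L u"
    if "lin_map (alg_tensor X Y) Z L'" "u \<in> carrier (alg_tensor X Y)"
      "\<forall>f\<in>carrier X. \<forall>g\<in>carrier Y. L' (pure_tensor X Y f g) = tensor_fun M1 M2 f g" for L' u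
    by (rule lin_map_alg_tensor_unique[OF complex_banach.axioms(1)[OF Z] that(1) L _ that(2)])
      (simp add: pure that(3))
  have norm: "injective_norm X Y u = mnorm Z (L u)" if "u \<in> carrier (alg_tensor X Y)" for u
    using injective_norm_eq[OF assms L[unfolded X_def Y_def Z_def] pure[unfolded X_def Y_def]
        that[unfolded X_def Y_def]]
    by (simp add: X_def Y_def Z_def)
  have dense: "\<exists>u\<in>carrier (alg_tensor X Y). mnorm Z (L u \<ominus>\<^bsub>Z\<^esub> z) < e" if "z \<in> carrier Z" "e > 0" for z e
    using tensor_fun_dense[OF assms L[unfolded X_def Y_def Z_def] pure[unfolded X_def Y_def]
        that(1)[unfolded Z_def] that(2)]
    by (simp add: X_def Y_def Z_def)
  let ?V = "alg_tensor_injective X Y"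
  have V: "module complex_field ?V" "lin_map ?V Z L"
    using module_with_norm[OF module_alg_tensor] L by (simp_all add: alg_tensor_injective_def)
  have iso: "mnorm Z (L u) = mnorm ?V u" if "u \<in> carrier ?V" for u
    using norm that by (simp add: alg_tensor_injective_def)
  have "\<exists>u\<in>carrier ?V. mnorm Z (L u \<ominus>\<^bsub>Z\<^esub> z) < e" if "z \<in> carrier Z" "e > 0" for z e
    using dense[OF that] by (simp add: alg_tensor_injective_def)
  then obtain T where "isometric_iso (injective_tensor X Y) Z T"
    and "\<And>u. u \<in> carrier ?V \<Longrightarrow> T (completion_embed ?V u) = L u"
    using completion_isometric_iso[OF V(1) Z V(2) iso] unfolding injective_tensor_def by blast
  then have "isometric_iso (injective_tensor X Y) Z T \<and>
      (\<forall>u\<in>carrier (alg_tensor X Y). T (completion_embed ?V u) = L u)"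
    by (simp add: alg_tensor_injective_def)
  then show ?thesis
    unfolding Let_def X_def[symmetric] Y_def[symmetric] Z_def[symmetric]
    using L pure unique by blast
qed

end
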